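(* Let $a,b,c,\mu\in\mathbb{C}$. In each identity below assume that the arguments of the three gamma functions in the numerator on the right-hand side have positive real parts, and that the lower (third) parameters of the hypergeometric functions in the two $w_j$'s occurring are not in $\mathbb{Z}_{\le0}$. (1) For $x\in(-\infty,0)\cup(1,\infty)$: $$\int_0^1y^{c-1}(1-y)^{b-c-\mu}w_1(y;a,b,c)|x-y|^{\mu-1}dy=\frac{\Gamma(-a-\mu+1)\Gamma(b-c-\mu+1)\Gamma(c)}{\Gamma(b-a-\mu+1)\Gamma(1-\mu)}|x|^{c+\mu-1}|x-1|^{b-c}w_4(x;a+\mu,b,c+\mu).$$ (2) For $x\in(-\infty,0)\cup(0,1)$: $$\int_1^\infty y^{c-1}(y-1)^{b-c-\mu}w_3(y;a,b,c)(y-x)^{\mu-1}dy=\frac{\Gamma(-a-\mu+1)\Gamma(b-c-\mu+1)\Gamma(a-b+1)}{\Gamma(-c-\mu+2)\Gamma(1-\mu)}|x|^{c+\mu-1}|x-1|^{b-c}w_2(x;a+\mu,b,c+\mu).$$ (3) For $x\in(-\infty,0)\cup(1,\infty)$: $$\int_0^1y^{c-1}(1-y)^{a-c-\mu}w_1(y;a,b,c)|x-y|^{\mu-1}dy=\frac{\Gamma(-b-\mu+1)\Gamma(a-c-\mu+1)\Gamma(c)}{\Gamma(a-b-\mu+1)\Gamma(1-\mu)}|x|^{c+\mu-1}|x-1|^{a-c}w_3(x;a,b+\mu,c+\mu).$$ (4) For $x\in(-\infty,0)\cup(0,1)$: $$\int_1^\infty y^{c-1}(y-1)^{a-c-\m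u}w_4(y;a,b,c)|x-y|^{\mu-1}dy=\frac{\Gamma(-b-\mu+1)\Gamma(a-c-\mu+1)\Gamma(b-a+1)}{\Gamma(-c-\mu+2)\Gamma(1-\mu)}|x|^{c+\mu-1}|x-1|^{a-c}w_2(x;a,b+\mu,c+\mu).$$
   Context: Write $F(a,b;c;z)={}_2F_1(a,b;c;z)$ for the Gauss hypergeometric function (power series for $|z|<1$, analytically continued to $\mathbb{C}\setminus[1,\infty)$, with $c\notin\mathbb{Z}_{\le0}$). Define $w_1(x;a,b,c)=F(a,b;c;x)$ for $x\in(-\infty,1)$; $w_2(x;a,b,c)=|x|^{1-c}F(a-c+1,b-c+1;2-c;x)$ for $x\in(-\infty,0)\cup(0,1)$; $w_3(x;a,b,c)=|x|^{-a}F(a,a-c+1;a-b+1;x^{-1})$ for $x\in(-\infty,0)\cup(1,\infty)$; $w_4(x;a,b,c)=|x|^{-b}F(b,b-c+1;b-a+1;x^{-1})$ for $x\in(-\infty,0)\cup(1,\infty)$. Convention: $1/\Gamma$ is entire, with value $0$ at nonpositive integers. *)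

theory Defs
  imports "HOL-Complex_Analysis.Complex_Analysis"
begin

definition is_hyp2F1_continuation :: "complex \<Rightarrow> complex \<Rightarrow> complex \<Rightarrow> (complex \<Rightarrow> complex) \<Rightarrow> bool" where
  "is_hyp2F1_continuation a b c f \<longleftrightarrow>
     f holomorphic_on (- complex_of_real ` {1..}) \<and>
     (\<forall>z. norm z < 1 \<longrightarrow> f z = eval_fps (fps_hypergeo [a, b] [c] 1) z)"

lemma eval_fps_hypergeo_2_1:
  "eval_fps (fps_hypergeo [a, b] [c] 1) z =
     (\<Sum>n. pochhammer a n * pochhammer b n / (pochhammer c n * fact n) * z ^ n)"
  for a b c z :: complex
  by (simp add: eval_fps_def)

text \<open>The slit plane is connected, so the continuation is unique there; the values on the
  cut \<open>[1,\<infinity>)\<close> are unspecified. The function is only meaningful when \<open>c\<close> is not a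
  nonpositive integer.\<close>

definition hyp2F1 :: "complex \<Rightarrow> complex \<Rightarrow> complex \<Rightarrow> complex \<Rightarrow> complex" where
  "hyp2F1 a b c = (SOME f. is_hyp2F1_continuation a b c f)"

text \<open>The functions below are meaningful on \<open>(-\<infinity>,1)\<close>, \<open>(-\<infinity>,0) \<union> (0,1)\<close>,
  \<open>(-\<infinity>,0) \<union> (1,\<infinity>)\<close> and \<open>(-\<infinity>,0) \<union> (1,\<infinity>)\<close>, respectively.\<close>

definition w1 :: "real \<Rightarrow> complex \<Rightarrow> complex \<Rightarrow> complex \<Rightarrow> complex" where
  "w1 x a b c = hyp2F1 a b c (of_real x)"

definition w2 :: "real \<Rightarrow> complex \<Rightarrow> complex \<Rightarrow> complex \<Rightarrow> complex" where
  "w2 x a b c = of_real \<bar>x\<bar> powr (1 - c) * hyp2F1 (a - c + 1) (b - c + 1) (2 - c) (of_real x)"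

definition w3 :: "real \<Rightarrow> complex \<Rightarrow> complex \<Rightarrow> complex \<Rightarrow> complex" where
  "w3 x a b c = of_real \<bar>x\<bar> powr (- a) * hyp2F1 a (a - c + 1) (a - b + 1) (of_real (inverse x))"

definition w4 :: "real \<Rightarrow> complex \<Rightarrow> complex \<Rightarrow> complex \<Rightarrow> complex" where
  "w4 x a b c = of_real \<bar>x\<bar> powr (- b) * hyp2F1 b (b - c + 1) (b - a + 1) (of_real (inverse x))"

text \<open>An identity between a Lebesgue integral and a value, including absolute convergence
  (the Bochner integral of a non-integrable function is \<open>0\<close>).\<close>

definition has_lebesgue_integral_on :: "(real \<Rightarrow> complex) \<Rightarrow> complex \<Rightarrow> real set \<Rightarrow> bool" where
  "has_lebesgue_integral_on f I S \<longleftrightarrow>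
     set_integrable lborel S f \<and> set_lebesgue_integral lborel S f = I"

end

theory Submission
  imports Defs
begin

text \<open>
  Put \<open>t = 1 - y\<close> and \<open>z = 1 / (1 - x)\<close>, so that \<open>|x - y| = |x - 1| (1 - z t)\<close>. The first integral
  becomes \<open>|x - 1|^(\<mu>-1)\<close> times \<open>\<integral> g(t) (1 - z t)^(\<mu>-1) dt\<close> over the unit interval, where
  \<open>g(t) = t^(b-c-\<mu>) (1-t)^(c-1) F(a,b;c;1-t)\<close>. For every integrable \<open>g\<close> such an integral is holomorphic
  in \<open>z\<close> off the cut \<open>[1,\<infinity>)\<close>, and its Taylor coefficients at \<open>0\<close> are the moments of \<open>g\<close>
  times \<open>(1-\<mu>)_n / n!\<close>. Here the moments are ratios of Gamma values, by termwise Beta integrals and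
  Gauss' summation of \<open>F(a,b;c;1)\<close>, so the integral is a multiple of
  \<open>F(1-a-\<mu>, b-c-\<mu>+1; b-a-\<mu>+1; z)\<close>, and Pfaff's transformation turns this into \<open>w4\<close>.
  The second identity is the first one under \<open>y \<mapsto> 1/y\<close>, with \<open>(b, c, x)\<close> replaced by
  \<open>(a-c+1, a-b+1, 1/x)\<close>; the other two follow from the symmetry of \<open>F\<close> in its upper parameters.
\<close>

section \<open>Integrals depending on a parameter\<close>

lemma holomorphic_bounded_imp_lipschitz_at_centre:
  fixes h :: "complex \<Rightarrow> complex"
  assumes h: "h holomorphic_on cball z r" and r: "r > 0"
    and bound: "\<And>w. w \<in> cball z r \<Longrightarrow> norm (h w) \<le> B"
    and w: "w \<in> ball z (r / 2)"
  shows "norm (h w - h z) \<le> 2 * B / r * norm (w - z)"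
proof (rule field_differentiable_bound[of "ball z (r / 2)"])
  fix v assume v: "v \<in> ball z (r / 2)"
  have sub: "cball v (r / 2) \<subseteq> cball z r"
    using v by (simp add: cball_subset_cball_iff dist_commute)
  show "(h has_field_derivative deriv h v) (at v within ball z (r / 2))"
    using v r by (intro has_field_derivative_at_within[OF holomorphic_derivI[of h "ball z r"]]
        holomorphic_on_subset[OF h ball_subset_cball]) auto
  have "norm ((deriv ^^ 1) h v) \<le> fact 1 * B / (r / 2) ^ 1"
  proof (rule Cauchy_inequality)
    show "h holomorphic_on ball v (r / 2)"
      using h sub ball_subset_cball by (meson holomorphic_on_subset subset_trans)
    show "continuous_on (cball v (r / 2)) h"
      using h sub holomorphic_on_imp_continuous_on holomorphic_on_subset by blast
    show "norm (h x) \<le> B" if "norm (v - x) = r / 2" for x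
      using that sub by (intro bound) (auto simp: dist_norm)
  qed (use r in auto)
  thus "norm (deriv h v) \<le> 2 * B / r" by (simp add: field_simps)
qed (use w r in auto)

lemma has_field_derivative_lebesgue_integral:
  fixes f :: "'b \<Rightarrow> 'a \<Rightarrow> 'b :: {banach, real_normed_field, second_countable_topology}"
  assumes r: "r > 0"
    and int: "\<And>w. w \<in> ball z r \<Longrightarrow> integrable M (f w)"
    and deriv: "\<And>t. t \<in> space M \<Longrightarrow> ((\<lambda>w. f w t) has_field_derivative D t) (at z)"
    and g: "integrable M g"
    and lipschitz: "\<And>w t. w \<in> ball z r \<Longrightarrow> t \<in> space M \<Longrightarrow>
                      norm (f w t - f z t) \<le> g t * norm (w - z)"
  shows "((\<lambda>w. \<integral>t. f w t \<partial>M) has_field_derivative (\<integral>t. D t \<partial>M)) (at z)"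
proof -
  have "((\<lambda>w. ((\<integral>t. f w t \<partial>M) - (\<integral>t. f z t \<partial>M)) / (w - z)) \<longlongrightarrow> (\<integral>t. D t \<partial>M))
          (at z within ball z r)"
    unfolding tendsto_at_iff_sequentially comp_def
  proof (intro allI impI)
    fix X :: "nat \<Rightarrow> 'b"
    assume "\<forall>i. X i \<in> ball z r - {z}" and "X \<longlonglongrightarrow> z"
    hence X: "\<And>i. X i \<in> ball z r" "\<And>i. X i \<noteq> z" "filterlim X (at z) sequentially"
      by (auto simp: filterlim_at)
    define q where "q = (\<lambda>i t. (f (X i) t - f z t) / (X i - z))"
    have int_q: "integrable M (q i)" for i
      unfolding q_def using X(1)[of i] int r by auto
    have q_tendsto: "(\<lambda>i. q i t) \<longlonglongrightarrow> D t" if "t \<in> space M" for t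
      using filterlim_compose[OF deriv[OF that, unfolded has_field_derivative_iff] X(3)]
      by (simp add: q_def)
    have "(\<lambda>i. \<integral>t. q i t \<partial>M) \<longlonglongrightarrow> (\<integral>t. D t \<partial>M)"
    proof (rule integral_dominated_convergence[OF _ _ g])
      show "D \<in> borel_measurable M"
        using int_q by (intro borel_measurable_LIMSEQ_metric[OF _ q_tendsto]) auto
      show "AE t in M. norm (q i t) \<le> g t" for i
        using X(1,2)[of i] lipschitz[of "X i"]
        by (intro AE_I2) (auto simp: q_def norm_divide divide_le_eq)
    qed (use int_q q_tendsto in auto)
    also have "(\<lambda>i. \<integral>t. q i t \<partial>M) = (\<lambda>i. ((\<integral>t. f (X i) t \<partial>M) - (\<integral>t. f z t \<partial>M)) / (X i - z))"
      using X(1) int r by (simp add: q_def)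
    finally show "(\<lambda>i. ((\<integral>t. f (X i) t \<partial>M) - (\<integral>t. f z t \<partial>M)) / (X i - z)) \<longlonglongrightarrow> (\<integral>t. D t \<partial>M)" .
  qed
  thus ?thesis using r by (simp add: has_field_derivative_iff at_within_open[of z "ball z r"])
qed

theorem holomorphic_on_lebesgue_integral:
  fixes f :: "complex \<Rightarrow> 'a \<Rightarrow> complex"
  assumes S: "open S"
    and meas: "\<And>z. z \<in> S \<Longrightarrow> f z \<in> borel_measurable M"
    and holo: "\<And>t. t \<in> space M \<Longrightarrow> (\<lambda>z. f z t) holomorphic_on S"
    and dom: "\<And>z. z \<in> S \<Longrightarrow> \<exists>r>0. \<exists>g. integrable M g \<and>
                 (\<forall>w\<in>S \<inter> cball z r. \<forall>t\<in>space M. norm (f w t) \<le> g t)"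
  shows "(\<lambda>z. \<integral>t. f z t \<partial>M) holomorphic_on S"
  unfolding holomorphic_on_open[OF S]
proof
  fix z assume z: "z \<in> S"
  from dom[OF z] obtain r1 g where r1: "r1 > 0" and g: "integrable M g"
    and bound: "\<And>w t. w \<in> S \<inter> cball z r1 \<Longrightarrow> t \<in> space M \<Longrightarrow> norm (f w t) \<le> g t" by blast
  obtain r2 where r2: "r2 > 0" "cball z r2 \<subseteq> S" using S z open_contains_cball by blast
  define r where "r = min r1 r2"
  have r: "r > 0" "cball z r \<subseteq> S" "cball z r \<subseteq> cball z r1" using r1 r2 by (auto simp: r_def)
  have "((\<lambda>w. \<integral>t. f w t \<partial>M) has_field_derivative (\<integral>t. deriv (\<lambda>z. f z t) z \<partial>M)) (at z)"
  proof (rule has_field_derivative_lebesgue_integral[where r = "r / 2" and g = "\<lambda>t. 2 * g t / r"])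
    show "((\<lambda>w. f w t) has_field_derivative deriv (\<lambda>z. f z t) z) (at z)" if "t \<in> space M" for t
      using holo[OF that] S z by (rule holomorphic_derivI)
    show "integrable M (f w)" if "w \<in> ball z (r / 2)" for w
    proof -
      have "w \<in> cball z r" using that r(1) by auto
      hence "w \<in> S \<inter> cball z r1" using r by blast
      hence "f w \<in> borel_measurable M" "AE t in M. norm (f w t) \<le> norm (g t)"
        using meas bound by (auto intro!: AE_I2 intro: order_trans[OF _ abs_ge_self])
      thus ?thesis by (rule Bochner_Integration.integrable_bound[OF g])
    qed
    show "norm (f w t - f z t) \<le> 2 * g t / r * norm (w - z)"
      if "w \<in> ball z (r / 2)" "t \<in> space M" for w t
    proof (rule holomorphic_bounded_imp_lipschitz_at_centre[OF _ r(1) _ that(1)])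
      show "(\<lambda>z. f z t) holomorphic_on cball z r"
        using holo[OF that(2)] r(2) by (rule holomorphic_on_subset)
      show "norm (f v t) \<le> g t" if "v \<in> cball z r" for v
        using that r(2,3) by (intro bound[OF _ \<open>t \<in> space M\<close>]) blast
    qed
  qed (use r g in auto)
  thus "\<exists>f'. ((\<lambda>z. \<integral>t. f z t \<partial>M) has_field_derivative f') (at z)" by blast
qed

lemma
  fixes g x :: "'a \<Rightarrow> 'b :: {banach, real_normed_field, second_countable_topology}"
  assumes int: "\<And>n. integrable M (\<lambda>t. g t * x t ^ n)"
    and conv: "\<And>t. t \<in> space M \<Longrightarrow> summable (\<lambda>n. norm (c n * x t ^ n))"
    and summable: "summable (\<lambda>n. norm (c n) * (\<integral>t. norm (g t * x t ^ n) \<partial>M))"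
  shows integrable_mult_powser: "integrable M (\<lambda>t. g t * (\<Sum>n. c n * x t ^ n))"
    and sums_integral_mult_powser:
      "(\<lambda>n. c n * (\<integral>t. g t * x t ^ n \<partial>M)) sums (\<integral>t. g t * (\<Sum>n. c n * x t ^ n) \<partial>M)"
proof -
  define p where "p = (\<lambda>n t. c n * (g t * x t ^ n))"
  have int_p: "integrable M (p n)" for n unfolding p_def by (intro integrable_mult_right int)
  have p_eq: "p n t = g t * (c n * x t ^ n)" for n t by (simp add: p_def mult_ac)
  have suminf_p: "(\<Sum>n. p n t) = g t * (\<Sum>n. c n * x t ^ n)" if "t \<in> space M" for t
    unfolding p_eq using summable_norm_cancel[OF conv[OF that]] by (rule suminf_mult)
  have AE_summable_p: "AE t in M. summable (\<lambda>n. norm (p n t))"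
    by (intro AE_I2) (auto simp: p_eq norm_mult[of "g _"] intro!: summable_mult conv)
  have summable_int_p: "summable (\<lambda>n. \<integral>t. norm (p n t) \<partial>M)"
    using summable by (simp add: p_def norm_mult[of "c _"])
  have "integrable M (\<lambda>t. \<Sum>n. p n t)"
    using int_p AE_summable_p summable_int_p by (rule integrable_suminf)
  thus "integrable M (\<lambda>t. g t * (\<Sum>n. c n * x t ^ n))"
    using suminf_p by (simp cong: Bochner_Integration.integrable_cong)
  have "(\<lambda>n. integral\<^sup>L M (p n)) sums (\<integral>t. (\<Sum>n. p n t) \<partial>M)"
    using int_p AE_summable_p summable_int_p by (rule sums_integral)
  also have "(\<lambda>n. integral\<^sup>L M (p n)) = (\<lambda>n. c n * (\<integral>t. g t * x t ^ n \<partial>M))"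
    by (simp add: p_def)
  also have "(\<integral>t. (\<Sum>n. p n t) \<partial>M) = (\<integral>t. g t * (\<Sum>n. c n * x t ^ n) \<partial>M)"
    by (intro Bochner_Integration.integral_cong refl suminf_p)
  finally show "(\<lambda>n. c n * (\<integral>t. g t * x t ^ n \<partial>M)) sums (\<integral>t. g t * (\<Sum>n. c n * x t ^ n) \<partial>M)" .
qed

section \<open>The slit plane\<close>

definition slit_plane :: "complex set" where
  "slit_plane = - complex_of_real ` {1..}"

lemma mem_slit_plane_iff: "z \<in> slit_plane \<longleftrightarrow> Im z \<noteq> 0 \<or> Re z < 1"
  by (force simp: slit_plane_def image_iff complex_eq_iff)

lemma one_minus_slit_plane: "z \<in> slit_plane \<Longrightarrow> 1 - z \<notin> \<real>\<^sub>\<le>\<^sub>0"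
  by (auto simp: mem_slit_plane_iff complex_nonpos_Reals_iff)

lemma slit_plane_mult_real:
  assumes "z \<in> slit_plane" "t \<in> {0..1}"
  shows "z * of_real t \<in> slit_plane"
proof -
  have "Re z * t < 1" if "Re z < 1"
    using that assms mult_left_le[of t "Re z"] mult_nonpos_nonneg[of "Re z" t]
    by (cases "Re z \<ge> 0") auto
  thus ?thesis using assms unfolding mem_slit_plane_iff by auto
qed

lemma slit_plane_Pfaff:
  assumes "z \<in> slit_plane"
  shows "z / (z - 1) \<in> slit_plane"
proof -
  have False if r: "z / (z - 1) = of_real r" "r \<ge> 1" for r
  proof -
    have "z \<noteq> 1" using assms by (auto simp: mem_slit_plane_iff)
    hence product_eq: "z * (of_real r - 1) = of_real r" using r(1) by (simp add: field_simps)
    have "r \<noteq> 1" using product_eq by auto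
    hence "z = of_real (r / (r - 1))" using product_eq r by (simp add: field_simps)
    moreover have "r / (r - 1) \<ge> 1" using r \<open>r \<noteq> 1\<close> by (simp add: field_simps)
    ultimately show False using assms unfolding slit_plane_def by blast
  qed
  thus ?thesis by (auto simp: slit_plane_def)
qed

lemma open_slit_plane: "open slit_plane"
proof -
  have "closed (complex_of_real ` {1..})"
    by (rule closed_injective_linear_image)
       (auto intro!: injI bounded_linear.linear bounded_linear_of_real)
  thus ?thesis by (simp add: open_Compl slit_plane_def)
qed

lemma connected_slit_plane: "connected slit_plane"
  unfolding slit_plane_def by (intro starlike_imp_connected starlike_slotted_complex_plane_right)

lemma ball_subset_slit_plane: "ball 0 1 \<subseteq> slit_plane"
proof
  fix z :: complex assume "z \<in> ball 0 1"
  thus "z \<in> slit_plane" using complex_Re_le_cmod[of z] by (simp add: mem_slit_plane_iff)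
qed

definition has_slit_expansion :: "(complex \<Rightarrow> complex) \<Rightarrow> complex fps \<Rightarrow> bool"
    (infixl \<open>has'_slit'_expansion\<close> 60) where
  "f has_slit_expansion F \<longleftrightarrow> f holomorphic_on slit_plane \<and> f has_fps_expansion F"

lemma has_slit_expansionD:
  assumes "f has_slit_expansion F"
  shows "f holomorphic_on slit_plane" "f has_fps_expansion F"
  using assms by (simp_all add: has_slit_expansion_def)

lemma has_slit_expansion_cmult_left:
  "f has_slit_expansion F \<Longrightarrow> (\<lambda>z. c * f z) has_slit_expansion (fps_const c * F)"
  unfolding has_slit_expansion_def
  by (intro conjI holomorphic_intros has_fps_expansion_cmult_left) auto

lemma has_slit_expansion_unique:
  assumes f: "f has_slit_expansion F" and g: "g has_slit_expansion F" and z: "z \<in> slit_plane"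
  shows "f z = g z"
proof -
  have "\<forall>\<^sub>F z in nhds 0. eval_fps F z = f z" "\<forall>\<^sub>F z in nhds 0. eval_fps F z = g z"
    using f g by (auto simp: has_slit_expansion_def has_fps_expansion_def)
  hence "\<forall>\<^sub>F z in nhds 0. f z = g z" by eventually_elim auto
  then obtain U where U: "open U" "0 \<in> U" "\<And>z. z \<in> U \<Longrightarrow> f z = g z"
    by (auto simp: eventually_nhds)
  show ?thesis
  proof (rule analytic_continuation_open[of "U \<inter> slit_plane" slit_plane f g])
    show "U \<inter> slit_plane \<noteq> {}" using U by (auto simp: mem_slit_plane_iff intro!: exI[of _ 0])
  qed (use U z open_slit_plane connected_slit_plane has_slit_expansionD f g in auto)
qed

section \<open>The kernel \<open>(1 - z t)\<^sup>-\<^sup>s\<close>\<close>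

lemma has_fps_expansion_unit_discI:
  fixes f :: "complex \<Rightarrow> complex"
  assumes "\<And>z. norm z < 1 \<Longrightarrow> (\<lambda>n. F $ n * z ^ n) sums f z"
  shows "f has_fps_expansion F"
proof (rule has_fps_expansionI)
  have "\<forall>\<^sub>F z in nhds (0 :: complex). z \<in> ball 0 1" by (rule eventually_nhds_in_open) auto
  thus "\<forall>\<^sub>F z in nhds 0. (\<lambda>n. F $ n * z ^ n) sums f z"
    by eventually_elim (use assms in auto)
qed

lemma sums_one_minus_powr:
  fixes z s :: complex
  assumes "norm z < 1"
  shows "(\<lambda>n. pochhammer s n / fact n * z ^ n) sums (1 - z) powr (- s)"
proof -
  have "((- s) gchoose n) * (- z) ^ n = pochhammer s n / fact n * z ^ n" for n
    by (simp add: gbinomial_pochhammer power_minus[of z])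
  thus ?thesis using gen_binomial_complex[of "- z" "- s"] assms by simp
qed

lemma summable_norm_one_minus_powr:
  fixes z s :: complex
  assumes "norm z < 1"
  shows "summable (\<lambda>n. norm (pochhammer s n / fact n * z ^ n))"
proof -
  obtain r where r: "norm z < r" "r < 1" using assms dense by blast
  hence "norm (complex_of_real r) < 1" "norm z < norm (complex_of_real r)"
    using norm_ge_zero[of z] by (auto simp del: norm_ge_zero)
  thus ?thesis using powser_insidea[OF sums_summable[OF sums_one_minus_powr]] by blast
qed

lemma slit_kernel_locally_bounded:
  assumes "z \<in> slit_plane"
  obtains r B where "r > 0" "\<And>w t. w \<in> cball z r \<Longrightarrow> t \<in> {0..1} \<Longrightarrow>
                       norm ((1 - w * of_real t) powr (- s)) \<le> B"
proof -
  obtain r where r: "r > 0" "cball z r \<subseteq> slit_plane"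
    using open_slit_plane assms open_contains_cball by blast
  define k where "k = (\<lambda>(w, t). (1 - w * complex_of_real t) powr (- s))"
  have "continuous_on (cball z r \<times> {0..1}) k"
    unfolding continuous_on_def k_def case_prod_unfold
    using r(2)
    by (intro ballI tendsto_powr_complex tendsto_intros one_minus_slit_plane slit_plane_mult_real) auto
  hence "bounded (k ` (cball z r \<times> {0..1}))"
    by (intro compact_imp_bounded compact_continuous_image compact_Times) auto
  thus ?thesis using r(1) that unfolding bounded_iff k_def by fast
qed

context
  fixes M :: "real measure" and g :: "real \<Rightarrow> complex" and s :: complex
  assumes space_M: "space M \<subseteq> {0..1}"
    and measurable_id [measurable]: "(\<lambda>t. t) \<in> borel_measurable M"
    and integrable_g: "integrable M g"
begin

lemma slit_kernel_locally_dominated: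
  assumes "z \<in> slit_plane"
  shows "\<exists>r>0. \<exists>h. integrable M h \<and> (\<forall>w\<in>slit_plane \<inter> cball z r. \<forall>t\<in>space M.
           norm (g t * (1 - w * of_real t) powr (- s)) \<le> h t)"
proof -
  obtain r B where "r > 0" "\<And>w t. w \<in> cball z r \<Longrightarrow> t \<in> {0..1} \<Longrightarrow>
      norm ((1 - w * of_real t) powr (- s)) \<le> B"
    using slit_kernel_locally_bounded[OF assms] by blast
  thus ?thesis using integrable_g space_M
    by (intro exI[of _ r] exI[of _ "\<lambda>t. norm (g t) * B"] conjI)
       (auto simp: norm_mult intro!: mult_left_mono)
qed

lemma measurable_slit_kernel:
  "(\<lambda>t. g t * (1 - z * of_real t) powr (- s)) \<in> borel_measurable M"
  using borel_measurable_integrable[OF integrable_g] by measurable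

lemma integrable_slit_kernel:
  assumes "z \<in> slit_plane"
  shows "integrable M (\<lambda>t. g t * (1 - z * of_real t) powr (- s))"
proof -
  from slit_kernel_locally_dominated[OF assms] obtain r h where "r > 0" "integrable M h"
    and "\<forall>w\<in>slit_plane \<inter> cball z r. \<forall>t\<in>space M. norm (g t * (1 - w * of_real t) powr (- s)) \<le> h t"
    by blast
  thus ?thesis using assms
    by (intro Bochner_Integration.integrable_bound[OF _ measurable_slit_kernel])
       (auto intro!: AE_I2 order_trans[OF _ abs_ge_self])
qed

lemma integrable_mult_power: "integrable M (\<lambda>t. g t * of_real t ^ n)"
proof (rule Bochner_Integration.integrable_bound[OF integrable_g])
  show "(\<lambda>t. g t * of_real t ^ n) \<in> borel_measurable M"
    using borel_measurable_integrable[OF integrable_g] by measurable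
  show "AE t in M. norm (g t * of_real t ^ n) \<le> norm (g t)"
    using space_M by (intro AE_I2) (auto simp: norm_mult norm_power intro!: mult_left_le power_le_one)
qed

lemma slit_kernel_sums:
  assumes z: "norm z < 1"
  shows "(\<lambda>n. pochhammer s n / fact n * z ^ n * (\<integral>t. g t * of_real t ^ n \<partial>M)) sums
           (\<integral>t. g t * (1 - z * of_real t) powr (- s) \<partial>M)"
proof -
  have zt: "norm (z * of_real t) < 1" if "t \<in> space M" for t
    using that space_M z mult_left_le[of "\<bar>t\<bar>" "norm z"] by (force simp: norm_mult)
  have power_eq: "pochhammer s n / fact n * z ^ n * of_real t ^ n =
              pochhammer s n / fact n * (z * of_real t) ^ n" for n and t :: real
    by (simp add: power_mult_distrib)
  have summable: "summable (\<lambda>n. norm (pochhammer s n / fact n * z ^ n) *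
                    (\<integral>t. norm (g t * of_real t ^ n) \<partial>M))"
  proof (rule summable_comparison_test'[OF summable_mult2[OF summable_norm_one_minus_powr[OF z]]])
    fix n
    have "(\<integral>t. norm (g t * of_real t ^ n) \<partial>M) \<le> (\<integral>t. norm (g t) \<partial>M)"
      using space_M by (intro integral_mono integrable_norm integrable_g integrable_mult_power)
        (auto simp: norm_mult norm_power intro!: mult_left_le power_le_one)
    thus "norm (norm (pochhammer s n / fact n * z ^ n) * (\<integral>t. norm (g t * of_real t ^ n) \<partial>M)) \<le>
            norm (pochhammer s n / fact n * z ^ n) * (\<integral>t. norm (g t) \<partial>M)"
      by (simp add: abs_mult mult_left_mono)
  qed
  have "(\<lambda>n. pochhammer s n / fact n * z ^ n * (\<integral>t. g t * of_real t ^ n \<partial>M)) sums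
          (\<integral>t. g t * (\<Sum>n. pochhammer s n / fact n * z ^ n * of_real t ^ n) \<partial>M)"
    using integrable_mult_power summable summable_norm_one_minus_powr[OF zt]
    by (intro sums_integral_mult_powser) (simp_all only: power_eq)
  also have "(\<integral>t. g t * (\<Sum>n. pochhammer s n / fact n * z ^ n * of_real t ^ n) \<partial>M) =
               (\<integral>t. g t * (1 - z * of_real t) powr (- s) \<partial>M)"
    unfolding power_eq using sums_one_minus_powr[OF zt]
    by (intro Bochner_Integration.integral_cong) (auto simp: sums_iff)
  finally show ?thesis .
qed

theorem has_slit_expansion_slit_kernel:
  "(\<lambda>z. \<integral>t. g t * (1 - z * of_real t) powr (- s) \<partial>M) has_slit_expansion
     Abs_fps (\<lambda>n. pochhammer s n / fact n * (\<integral>t. g t * of_real t ^ n \<partial>M))"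
  unfolding has_slit_expansion_def
proof
  show "(\<lambda>z. \<integral>t. g t * (1 - z * of_real t) powr (- s) \<partial>M) holomorphic_on slit_plane"
    using space_M
    by (intro holomorphic_on_lebesgue_integral open_slit_plane measurable_slit_kernel
          slit_kernel_locally_dominated holomorphic_intros one_minus_slit_plane slit_plane_mult_real) auto
  show "(\<lambda>z. \<integral>t. g t * (1 - z * of_real t) powr (- s) \<partial>M) has_fps_expansion
          Abs_fps (\<lambda>n. pochhammer s n / fact n * (\<integral>t. g t * of_real t ^ n \<partial>M))"
    by (rule has_fps_expansion_unit_discI) (use slit_kernel_sums in \<open>simp add: mult_ac\<close>)
qed

end

section \<open>The complex Beta integral\<close>

lemma holomorphic_right_half_plane_eqI:
  fixes f g :: "complex \<Rightarrow> complex"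
  assumes f: "f holomorphic_on {z. Re z > 0}" and g: "g holomorphic_on {z. Re z > 0}"
    and eq: "\<And>x. x > 0 \<Longrightarrow> f (of_real x) = g (of_real x)" and z: "Re z > 0"
  shows "f z = g z"
proof -
  have "(\<lambda>z. f z - g z) z = 0"
  proof (rule analytic_continuation[where f = "\<lambda>z. f z - g z" and S = "{z. Re z > 0}"
          and U = "of_real ` {0<..}" and \<xi> = 1])
    show "(\<lambda>z. f z - g z) holomorphic_on {z. Re z > 0}"
      using f g by (intro holomorphic_intros)
    show "open {z. Re z > 0}" by (rule open_halfspace_Re_gt)
    show "connected {z. Re z > 0}" by (intro convex_connected convex_halfspace_Re_gt)
    have "complex_of_real 1 islimpt of_real ` {0<..}"
      by (intro islimpt_isCont_image continuous_intros interior_limit_point)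
         (auto simp: eventually_at_filter interior_open)
    thus "(1 :: complex) islimpt of_real ` {0<..}" by simp
  qed (use eq z in auto)
  thus ?thesis by simp
qed

abbreviation lborel01 :: "real measure" where
  "lborel01 \<equiv> restrict_space lborel {0<..<1}"

lemma space_lborel01: "space lborel01 = {0<..<1}"
  by (simp add: space_restrict_space)

lemma measurable_ident_lborel01 [measurable]: "(\<lambda>t. t) \<in> borel_measurable lborel01"
  by (intro measurable_restrict_space1) simp

lemma has_bochner_integral_restrict_lborel_iff:
  fixes f :: "real \<Rightarrow> 'a :: {banach, second_countable_topology}"
  assumes "S \<in> sets borel"
  shows "has_bochner_integral (restrict_space lborel S) f I \<longleftrightarrow>
           set_integrable lborel S f \<and> set_lebesgue_integral lborel S f = I"
  using assms by (simp add: has_bochner_integral_iff integrable_restrict_space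
      integral_restrict_space set_integrable_def set_lebesgue_integral_def)

lemma has_bochner_integral_lborel01_reflect:
  fixes f :: "real \<Rightarrow> 'a :: {banach, second_countable_topology}"
  assumes "has_bochner_integral lborel01 f I"
  shows "has_bochner_integral lborel01 (\<lambda>t. f (1 - t)) I"
proof -
  define g where "g = (\<lambda>t. indicator {0<..<1::real} t *\<^sub>R f t)"
  have "has_bochner_integral lborel g I"
    using assms unfolding g_def by (subst (asm) has_bochner_integral_restrict_space) auto
  hence "has_bochner_integral lborel (\<lambda>t. g (1 - t)) I"
    using lborel_has_bochner_integral_real_affine_iff[of "-1" g I 1] by simp
  also have "(\<lambda>t. g (1 - t)) = (\<lambda>t. indicator {0<..<1::real} t *\<^sub>R f (1 - t))"
    by (auto simp: g_def fun_eq_iff indicator_def)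
  finally show ?thesis by (subst has_bochner_integral_restrict_space) auto
qed

lemma has_bochner_integral_Beta_real:
  fixes x y :: real
  assumes "x > 0" "y > 0"
  shows "has_bochner_integral lborel01 (\<lambda>t. t powr (x - 1) * (1 - t) powr (y - 1)) (Beta x y)"
proof -
  have integrable: "set_integrable lborel {0<..<1} (\<lambda>t. t powr (x - 1) * (1 - t) powr (y - 1))"
    by (rule set_integrable_subset[OF integrable_Beta[OF assms]]) auto
  have "((\<lambda>t. t powr (x - 1) * (1 - t) powr (y - 1)) has_integral Beta x y) {0<..<1}"
    using has_integral_Beta_real[OF assms] by (simp add: has_integral_Icc_iff_Ioo)
  with set_borel_integral_eq_integral(2)[OF integrable] integrable show ?thesis
    by (simp add: has_bochner_integral_restrict_lborel_iff integral_unique)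
qed

definition Beta_integrand :: "complex \<Rightarrow> complex \<Rightarrow> real \<Rightarrow> complex" where
  "Beta_integrand z w t = of_real t powr (z - 1) * of_real (1 - t) powr (w - 1)"

lemma norm_Beta_integrand:
  "t \<in> {0<..<1} \<Longrightarrow> norm (Beta_integrand z w t) = t powr (Re z - 1) * (1 - t) powr (Re w - 1)"
  using norm_powr_real_powr[of "of_real t" "z - 1"] norm_powr_real_powr[of "of_real (1 - t)" "w - 1"]
  by (simp add: Beta_integrand_def norm_mult del: of_real_diff)

lemma Beta_integrand_reflect: "Beta_integrand z w (1 - t) = Beta_integrand w z t"
  by (simp add: Beta_integrand_def mult.commute)

lemma Beta_integrand_mult_power:
  assumes "t > 0"
  shows "Beta_integrand z w t * of_real t ^ n = Beta_integrand (z + of_nat n) w t"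
proof -
  have "complex_of_real t powr (z + of_nat n - 1) = of_real t powr (z - 1) * of_real t ^ n"
    using assms powr_add[of "complex_of_real t" "z - 1" "of_nat n"]
    by (simp add: powr_nat algebra_simps)
  thus ?thesis by (simp add: Beta_integrand_def)
qed

lemma measurable_Beta_integrand [measurable]: "Beta_integrand z w \<in> borel_measurable lborel01"
  unfolding Beta_integrand_def by measurable

lemma integrable_Beta_integrand:
  assumes "Re z > 0" "Re w > 0"
  shows "integrable lborel01 (Beta_integrand z w)"
proof (rule Bochner_Integration.integrable_bound[OF _ measurable_Beta_integrand])
  show "integrable lborel01 (\<lambda>t. t powr (Re z - 1) * (1 - t) powr (Re w - 1))"
    using has_bochner_integral_Beta_real[OF assms] by (simp add: has_bochner_integral_iff)
qed (auto intro!: AE_I2 simp: norm_Beta_integrand space_lborel01)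

lemma holomorphic_Beta_integral:
  assumes w: "Re w > 0"
  shows "(\<lambda>z. \<integral>t. Beta_integrand z w t \<partial>lborel01) holomorphic_on {z. Re z > 0}"
proof (rule holomorphic_on_lebesgue_integral)
  fix z :: complex assume "z \<in> {z. Re z > 0}"
  hence z: "Re z > 0" by simp
  define h where "h = (\<lambda>t. t powr (Re z / 2 - 1) * (1 - t) powr (Re w - 1))"
  have "norm (Beta_integrand v w t) \<le> h t"
    if v: "v \<in> cball z (Re z / 2)" and t: "t \<in> space lborel01" for v t
  proof -
    have "\<bar>Re (z - v)\<bar> \<le> Re z / 2"
      using v abs_Re_le_cmod[of "z - v"] by (auto simp: dist_norm)
    hence "Re v \<ge> Re z / 2" by (simp add: abs_if split: if_splits)
    thus ?thesis
      using t by (auto simp: h_def norm_Beta_integrand space_lborel01 intro!: mult_right_mono powr_mono')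
  qed
  moreover have "integrable lborel01 h"
    using has_bochner_integral_Beta_real[of "Re z / 2" "Re w"] z w
    by (simp add: h_def has_bochner_integral_iff)
  ultimately show "\<exists>r>0. \<exists>g. integrable lborel01 g \<and>
      (\<forall>v\<in>{z. Re z > 0} \<inter> cball z r. \<forall>t\<in>space lborel01. norm (Beta_integrand v w t) \<le> g t)"
    using z by (intro exI[of _ "Re z / 2"] exI[of _ h]) auto
next
  fix t assume "t \<in> space lborel01"
  thus "(\<lambda>z. Beta_integrand z w t) holomorphic_on {z. Re z > 0}"
    unfolding Beta_integrand_def by (intro holomorphic_intros) (auto simp: space_lborel01)
qed (use open_halfspace_Re_gt in auto)

lemma Beta_integral_commute:
  assumes "Re z > 0" "Re w > 0"
  shows "(\<integral>t. Beta_integrand z w t \<partial>lborel01) = (\<integral>t. Beta_integrand w z t \<partial>lborel01)"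
  using has_bochner_integral_lborel01_reflect[OF
      has_bochner_integral_integrable[OF integrable_Beta_integrand[OF assms(2,1)]]]
  by (simp add: has_bochner_integral_iff Beta_integrand_reflect)

lemma Re_pos_imp_not_nonpos_Int: "Re z > 0 \<Longrightarrow> z \<notin> \<int>\<^sub>\<le>\<^sub>0"
  by (auto elim!: nonpos_Ints_cases)

theorem has_bochner_integral_Beta_complex:
  assumes z: "Re z > 0" and w: "Re w > 0"
  shows "has_bochner_integral lborel01 (Beta_integrand z w) (Beta z w)"
proof -
  define I where "I = (\<lambda>z w. \<integral>t. Beta_integrand z w t \<partial>lborel01)"
  have I_of_real: "I (of_real x) (of_real y) = Beta (of_real x) (of_real y)" if "x > 0" "y > 0" for x y
  proof -
    have "I (of_real x) (of_real y) =
            (\<integral>t. complex_of_real (t powr (x - 1) * (1 - t) powr (y - 1)) \<partial>lborel01)"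
      unfolding I_def Beta_integrand_def
      by (intro Bochner_Integration.integral_cong) (auto simp: space_lborel01 simp flip: powr_of_real)
    also have "\<dots> = of_real (Beta x y)"
      using has_bochner_integral_of_real[where 'a = complex, OF has_bochner_integral_Beta_real[OF that]]
      by (simp only: has_bochner_integral_iff)
    finally show ?thesis by (simp add: Beta_complex_of_real)
  qed
  have I_of_real_right: "I z (of_real y) = Beta z (of_real y)" if "Re z > 0" "y > 0" for z y
  proof (rule holomorphic_right_half_plane_eqI[of "\<lambda>z. I z (of_real y)" "\<lambda>z. Beta z (of_real y)"])
    show "(\<lambda>z. I z (of_real y)) holomorphic_on {z. Re z > 0}"
      unfolding I_def by (rule holomorphic_Beta_integral) (use that in simp)
  qed (use that I_of_real Re_pos_imp_not_nonpos_Int in \<open>auto intro!: holomorphic_intros\<close>)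
  have "I z w = Beta z w"
  proof (rule holomorphic_right_half_plane_eqI[of "I z" "Beta z"])
    have "(\<lambda>w. I w z) holomorphic_on {z. Re z > 0}"
      unfolding I_def by (rule holomorphic_Beta_integral) fact
    thus "I z holomorphic_on {z. Re z > 0}"
      by (rule holomorphic_transform) (use z Beta_integral_commute in \<open>simp add: I_def\<close>)
  qed (use z w I_of_real_right Re_pos_imp_not_nonpos_Int in \<open>auto intro!: holomorphic_intros\<close>)
  thus ?thesis using integrable_Beta_integrand[OF z w] by (simp add: I_def has_bochner_integral_iff)
qed

lemma has_bochner_integral_Beta_moment:
  assumes "Re z > 0" "Re w > 0"
  shows "has_bochner_integral lborel01 (\<lambda>t. Beta_integrand z w t * of_real t ^ n)
           (Beta (z + of_nat n) w)"
proof -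
  have "has_bochner_integral lborel01 (Beta_integrand (z + of_nat n) w) (Beta (z + of_nat n) w)"
    using assms by (intro has_bochner_integral_Beta_complex) auto
  also have "?this \<longleftrightarrow> ?thesis"
    by (intro has_bochner_integral_cong) (auto simp: space_lborel01 Beta_integrand_mult_power)
  finally show ?thesis .
qed

lemma integral_norm_Beta_moment:
  assumes "Re z > 0" "Re w > 0"
  shows "(\<integral>t. norm (Beta_integrand z w t * of_real t ^ n) \<partial>lborel01) = Beta (Re z + real n) (Re w)"
proof -
  have "(\<integral>t. norm (Beta_integrand z w t * of_real t ^ n) \<partial>lborel01) =
          (\<integral>t. t powr (Re z + real n - 1) * (1 - t) powr (Re w - 1) \<partial>lborel01)"
    by (intro Bochner_Integration.integral_cong)
       (auto simp: space_lborel01 Beta_integrand_mult_power norm_Beta_integrand)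
  also have "\<dots> = Beta (Re z + real n) (Re w)"
    using has_bochner_integral_Beta_real[of "Re z + real n" "Re w"] assms
    by (simp add: has_bochner_integral_iff)
  finally show ?thesis .
qed

lemma not_nonpos_Int_add_of_nat:
  "z \<notin> \<int>\<^sub>\<le>\<^sub>0 \<Longrightarrow> z + of_nat n \<notin> \<int>\<^sub>\<le>\<^sub>0" for z :: "'a :: ring_char_0"
  by (induction n) (auto simp: add.assoc[symmetric] add.commute[of 1] dest: plus_one_in_nonpos_Ints_imp)

lemma Beta_add_of_nat:
  fixes x y :: "'a :: Gamma"
  assumes "x \<notin> \<int>\<^sub>\<le>\<^sub>0" "x + y \<notin> \<int>\<^sub>\<le>\<^sub>0"
  shows "Beta (x + of_nat n) y = Beta x y * (pochhammer x n / pochhammer (x + y) n)"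
proof -
  have "x + y + of_nat n \<notin> \<int>\<^sub>\<le>\<^sub>0" using assms(2) not_nonpos_Int_add_of_nat by blast
  moreover have "pochhammer x n \<noteq> 0" "pochhammer (x + y) n \<noteq> 0"
    using assms pochhammer_eq_0_imp_nonpos_Int by blast+
  ultimately show ?thesis
    using pochhammer_Gamma[OF assms(1), of n] pochhammer_Gamma[OF assms(2), of n] assms
    by (simp add: Beta_def Gamma_eq_zero_iff field_simps add_ac)
qed

section \<open>Gauss' summation theorem\<close>

lemma pochhammer_nonzero: "c \<notin> \<int>\<^sub>\<le>\<^sub>0 \<Longrightarrow> pochhammer c n \<noteq> (0 :: complex)"
  using pochhammer_eq_0_imp_nonpos_Int by blast

lemma add_of_nat_nonzero: "c \<notin> \<int>\<^sub>\<le>\<^sub>0 \<Longrightarrow> c + of_nat n \<noteq> (0 :: complex)"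
  by (metis add_eq_0_iff2 minus_of_nat_in_nonpos_Ints)

lemma inverse_Gamma_series'_LIMSEQ:
  "(\<lambda>n. inverse (Gamma_series' z n)) \<longlonglongrightarrow> rGamma z" for z :: complex
proof (cases "z \<in> \<int>\<^sub>\<le>\<^sub>0")
  case True
  then obtain k where k: "z = - of_nat k" by (elim nonpos_Ints_cases')
  have "\<forall>\<^sub>F n in sequentially. inverse (Gamma_series' z n) = 0"
    using Gamma_series'_minus_of_nat[of k] unfolding k by eventually_elim simp
  hence "(\<lambda>n. inverse (Gamma_series' z n)) \<longlonglongrightarrow> 0" by (rule tendsto_eventually)
  moreover have "rGamma z = 0" using True by (simp add: rGamma_eq_zero_iff)
  ultimately show ?thesis by simp
next
  case False
  hence "(\<lambda>n. inverse (Gamma_series' z n)) \<longlonglongrightarrow> inverse (Gamma z)"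
    by (intro tendsto_inverse Gamma_series'_LIMSEQ) (simp add: Gamma_eq_zero_iff)
  thus ?thesis by (simp add: rGamma_inverse_Gamma)
qed

lemma pochhammer_ratio_LIMSEQ:
  fixes a c :: complex
  shows "(\<lambda>n. pochhammer a n / pochhammer c n * of_nat n powr (c - a)) \<longlonglongrightarrow> rGamma a * Gamma c"
proof (rule Lim_transform_eventually)
  show "(\<lambda>n. inverse (Gamma_series' a n) * Gamma_series' c n) \<longlonglongrightarrow> rGamma a * Gamma c"
    by (intro tendsto_mult inverse_Gamma_series'_LIMSEQ Gamma_series'_LIMSEQ)
  show "\<forall>\<^sub>F n in sequentially. inverse (Gamma_series' a n) * Gamma_series' c n =
          pochhammer a n / pochhammer c n * of_nat n powr (c - a)"
    using eventually_gt_at_top[of 0]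
    by eventually_elim (simp add: Gamma_series'_def powr_def left_diff_distrib exp_diff Ln_of_nat)
qed

lemma norm_in_bigo_powr_Re:
  fixes f :: "nat \<Rightarrow> complex"
  assumes "(\<lambda>n. f n * of_nat n powr (- w)) \<longlonglongrightarrow> L"
  shows "(\<lambda>n. norm (f n)) \<in> O(\<lambda>n. real n powr Re w)"
proof (rule bigoI_tendsto)
  show "(\<lambda>n. norm (f n) / real n powr Re w) \<longlonglongrightarrow> norm L"
  proof (rule Lim_transform_eventually[OF tendsto_norm[OF assms]])
    show "\<forall>\<^sub>F n in sequentially. norm (f n * of_nat n powr (- w)) = norm (f n) / real n powr Re w"
      using eventually_gt_at_top[of 0]
      by eventually_elim (simp add: norm_mult norm_powr_real_powr powr_minus norm_inverse divide_inverse)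
  qed
  show "\<forall>\<^sub>F n in sequentially. real n powr Re w \<noteq> 0"
    using eventually_gt_at_top[of 0] by eventually_elim simp
qed

definition hyp2F1_coeff :: "complex \<Rightarrow> complex \<Rightarrow> complex \<Rightarrow> nat \<Rightarrow> complex" where
  "hyp2F1_coeff a b c n = pochhammer a n * pochhammer b n / (pochhammer c n * fact n)"

lemma hyp2F1_coeff_0 [simp]: "hyp2F1_coeff a b c 0 = 1"
  by (simp add: hyp2F1_coeff_def)

lemma hyp2F1_coeff_Suc:
  "hyp2F1_coeff a b c (Suc n) =
     hyp2F1_coeff a b c n * ((a + of_nat n) * (b + of_nat n) / ((c + of_nat n) * of_nat (Suc n)))"
  by (simp add: hyp2F1_coeff_def pochhammer_Suc mult_ac)

lemma hyp2F1_coeff_commute: "hyp2F1_coeff a b c = hyp2F1_coeff b a c"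
  by (simp add: hyp2F1_coeff_def fun_eq_iff)

lemma hyp2F1_coeff_LIMSEQ:
  "(\<lambda>n. hyp2F1_coeff a b c n * of_nat n powr (c - a - b + 1)) \<longlonglongrightarrow> rGamma a * Gamma c * rGamma b"
proof -
  have "(\<lambda>n. (pochhammer a n / pochhammer c n * of_nat n powr (c - a)) *
             (pochhammer b n / pochhammer 1 n * of_nat n powr (1 - b))) \<longlonglongrightarrow>
          rGamma a * Gamma c * (rGamma b * Gamma 1)"
    by (intro tendsto_mult pochhammer_ratio_LIMSEQ)
  moreover have "(pochhammer a n / pochhammer c n * of_nat n powr (c - a)) *
             (pochhammer b n / pochhammer 1 n * of_nat n powr (1 - b)) =
           hyp2F1_coeff a b c n * of_nat n powr (c - a - b + 1)" for n
  proof -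
    have "of_nat n powr (c - a - b + 1) = (of_nat n :: complex) powr (c - a) * of_nat n powr (1 - b)"
      by (simp add: algebra_simps flip: powr_add)
    thus ?thesis by (simp add: hyp2F1_coeff_def pochhammer_fact mult_ac)
  qed
  ultimately show ?thesis by simp
qed

lemma norm_hyp2F1_coeff_bigo:
  "(\<lambda>n. norm (hyp2F1_coeff a b c n)) \<in> O(\<lambda>n. real n powr (Re (a + b - c) - 1))"
proof -
  have "(\<lambda>n. hyp2F1_coeff a b c n * of_nat n powr (- (a + b - c - 1))) \<longlonglongrightarrow> rGamma a * Gamma c * rGamma b"
    using hyp2F1_coeff_LIMSEQ[of a b c] by (simp add: algebra_simps)
  from norm_in_bigo_powr_Re[OF this] show ?thesis by simp
qed

lemma summable_norm_hyp2F1_coeff: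
  assumes "Re (c - a - b) > 0"
  shows "summable (\<lambda>n. norm (hyp2F1_coeff a b c n))"
  by (rule summable_comparison_test_bigo[OF _ norm_hyp2F1_coeff_bigo])
     (use assms in \<open>simp add: summable_real_powr_iff\<close>)

lemma of_nat_mult_hyp2F1_coeff_LIMSEQ_0:
  assumes "Re (c - a - b) > 0"
  shows "(\<lambda>n. of_nat n * hyp2F1_coeff a b c n) \<longlonglongrightarrow> 0"
proof (rule Lim_transform_eventually)
  have "(\<lambda>n. of_nat n powr (a + b - c)) \<longlonglongrightarrow> (0 :: complex)"
    by (rule tendsto_neg_powr_complex_of_nat) (use assms in \<open>auto intro: filterlim_ident\<close>)
  from tendsto_mult[OF hyp2F1_coeff_LIMSEQ this]
  show "(\<lambda>n. hyp2F1_coeff a b c n * of_nat n powr (c - a - b + 1) * of_nat n powr (a + b - c)) \<longlonglongrightarrow> 0"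
    by simp
  show "\<forall>\<^sub>F n in sequentially.
          hyp2F1_coeff a b c n * of_nat n powr (c - a - b + 1) * of_nat n powr (a + b - c) =
          of_nat n * hyp2F1_coeff a b c n"
    by (simp add: mult.assoc flip: powr_add)
qed

lemma hyp2F1_coeff_increase_lower_param:
  assumes "c \<notin> \<int>\<^sub>\<le>\<^sub>0"
  shows "hyp2F1_coeff a b (c + 1) n = hyp2F1_coeff a b c n * (c / (c + of_nat n))"
proof -
  have "c * pochhammer (c + 1) n = pochhammer c n * (c + of_nat n)"
    using pochhammer_rec[of c n] pochhammer_Suc[of c n] by simp
  moreover have "c \<noteq> 0" using assms by auto
  ultimately have "pochhammer (c + 1) n = pochhammer c n * (c + of_nat n) / c"
    by (simp add: field_simps)
  thus ?thesis using \<open>c \<noteq> 0\<close> by (simp add: hyp2F1_coeff_def)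
qed

lemma hyp2F1_coeff_telescope:
  assumes c: "c \<notin> \<int>\<^sub>\<le>\<^sub>0"
  shows "c * (c - a - b) * hyp2F1_coeff a b c n - (c - a) * (c - b) * hyp2F1_coeff a b (c + 1) n =
           c * (of_nat n * hyp2F1_coeff a b c n) - c * (of_nat (Suc n) * hyp2F1_coeff a b c (Suc n))"
proof -
  define u N where "u = hyp2F1_coeff a b c n" and "N = (of_nat n :: complex)"
  have nonzero: "c + N \<noteq> 0" "1 + N \<noteq> 0"
    using add_of_nat_nonzero[OF c, of n] of_nat_neq_0[of n, where ?'a = complex]
    by (simp_all add: N_def)
  hence "of_nat (Suc n) * hyp2F1_coeff a b c (Suc n) = u * ((a + N) * (b + N) / (c + N))"
    by (simp add: hyp2F1_coeff_Suc u_def N_def)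
  moreover have "c * (c - a - b) * u - (c - a) * (c - b) * (u * (c / (c + N))) =
                   c * (N * u) - c * (u * ((a + N) * (b + N) / (c + N)))"
    using nonzero by (simp add: divide_simps) algebra
  ultimately show ?thesis by (simp only: hyp2F1_coeff_increase_lower_param[OF c] u_def N_def)
qed

lemma suminf_hyp2F1_coeff_increase_lower_param:
  assumes c: "c \<notin> \<int>\<^sub>\<le>\<^sub>0" and abc: "Re (c - a - b) > 0"
  shows "c * (c - a - b) * suminf (hyp2F1_coeff a b c) =
           (c - a) * (c - b) * suminf (hyp2F1_coeff a b (c + 1))"
proof -
  have "hyp2F1_coeff a b c sums suminf (hyp2F1_coeff a b c)"
    "hyp2F1_coeff a b (c + 1) sums suminf (hyp2F1_coeff a b (c + 1))"
    using abc by (auto intro!: summable_sums summable_norm_cancel summable_norm_hyp2F1_coeff)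
  hence "(\<lambda>n. c * (c - a - b) * hyp2F1_coeff a b c n -
               (c - a) * (c - b) * hyp2F1_coeff a b (c + 1) n) sums
           (c * (c - a - b) * suminf (hyp2F1_coeff a b c) -
            (c - a) * (c - b) * suminf (hyp2F1_coeff a b (c + 1)))"
    by (intro sums_diff sums_mult)
  moreover have "(\<lambda>n. c * (c - a - b) * hyp2F1_coeff a b c n -
                      (c - a) * (c - b) * hyp2F1_coeff a b (c + 1) n) sums 0"
    using telescope_sums'[OF tendsto_mult_left[OF of_nat_mult_hyp2F1_coeff_LIMSEQ_0[OF abc], of c]]
    by (simp add: hyp2F1_coeff_telescope[OF c])
  ultimately show ?thesis using sums_unique2 by fastforce
qed

lemma suminf_hyp2F1_coeff_increase_lower_param_iterate:
  assumes c: "c \<notin> \<int>\<^sub>\<le>\<^sub>0" and abc: "Re (c - a - b) > 0"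
  shows "suminf (hyp2F1_coeff a b c) = pochhammer (c - a) n * pochhammer (c - b) n /
           (pochhammer c n * pochhammer (c - a - b) n) * suminf (hyp2F1_coeff a b (c + of_nat n))"
proof (induction n)
  case (Suc n)
  have "c + of_nat n \<noteq> 0" "c - a - b + of_nat n \<noteq> 0"
    using add_of_nat_nonzero[OF c] add_of_nat_nonzero[OF Re_pos_imp_not_nonpos_Int[OF abc]] by auto
  moreover have "(c + of_nat n) * (c - a - b + of_nat n) * suminf (hyp2F1_coeff a b (c + of_nat n)) =
     (c - a + of_nat n) * (c - b + of_nat n) * suminf (hyp2F1_coeff a b (c + of_nat (Suc n)))"
    using suminf_hyp2F1_coeff_increase_lower_param[OF not_nonpos_Int_add_of_nat[OF c], of n a b] abc
    by (simp add: algebra_simps)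
  ultimately have "suminf (hyp2F1_coeff a b (c + of_nat n)) = (c - a + of_nat n) * (c - b + of_nat n) /
     ((c + of_nat n) * (c - a - b + of_nat n)) * suminf (hyp2F1_coeff a b (c + of_nat (Suc n)))"
    by (simp add: nonzero_eq_divide_eq mult_ac)
  with Suc.IH show ?case by (simp add: pochhammer_Suc mult_ac)
qed auto

lemma norm_pochhammer_ge:
  assumes "0 < x" "x \<le> Re z"
  shows "pochhammer x n \<le> norm (pochhammer z n)"
proof (induction n)
  case (Suc n)
  have "x + real n \<le> norm (z + of_nat n)"
    using assms complex_Re_le_cmod[of "z + of_nat n"] by simp
  thus ?case using Suc.IH assms
    unfolding pochhammer_Suc norm_mult by (intro mult_mono) auto
qed simp

lemma norm_hyp2F1_coeff_le:
  assumes "0 < x" "x \<le> Re c"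
  shows "norm (hyp2F1_coeff a b c n) \<le> norm (hyp2F1_coeff a b (of_real x) n)"
  using norm_pochhammer_ge[OF assms, of n] pochhammer_pos[OF assms(1), of n]
  by (auto simp: hyp2F1_coeff_def norm_divide norm_mult pochhammer_of_real
      intro!: divide_left_mono mult_right_mono mult_pos_pos)

lemma hyp2F1_coeff_shift_LIMSEQ:
  "(\<lambda>m. hyp2F1_coeff a b (c + of_nat m) n) \<longlonglongrightarrow> (if n = 0 then 1 else 0)"
proof (induction n)
  case (Suc n)
  have "filterlim (\<lambda>m. c + of_nat n + of_nat m) at_infinity sequentially"
    by (rule tendsto_add_filterlim_at_infinity[OF tendsto_const tendsto_of_nat])
  hence "(\<lambda>m. hyp2F1_coeff a b (c + of_nat m) n * ((a + of_nat n) * (b + of_nat n) / of_nat (Suc n) /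
            (c + of_nat n + of_nat m))) \<longlonglongrightarrow> (if n = 0 then 1 else 0) * 0"
    by (intro tendsto_mult Suc.IH tendsto_divide_0[OF tendsto_const])
  thus ?case by (simp add: hyp2F1_coeff_Suc add_ac mult_ac)
qed simp

lemma suminf_hyp2F1_coeff_shift_LIMSEQ:
  assumes abc: "Re (c - a - b) > 0"
  shows "(\<lambda>m. suminf (hyp2F1_coeff a b (c + of_nat m))) \<longlonglongrightarrow> 1"
proof -
  obtain N where N: "real N > - Re c" using reals_Archimedean2 by blast
  define x where "x = Re c + real N"
  have "\<forall>\<^sub>F (k, m) in at_top \<times>\<^sub>F sequentially.
          norm (hyp2F1_coeff a b (c + of_nat m) k) \<le> norm (hyp2F1_coeff a b (of_real x) k)"
    using eventually_prodI[OF eventually_True eventually_ge_at_top[of N]]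
    by eventually_elim (use N in \<open>auto simp: x_def intro!: norm_hyp2F1_coeff_le simp del: of_real_add\<close>)
  moreover have "summable (\<lambda>k. norm (hyp2F1_coeff a b (of_real x) k))"
    by (rule summable_norm_hyp2F1_coeff) (use abc in \<open>simp add: x_def\<close>)
  ultimately have "(\<lambda>m. suminf (hyp2F1_coeff a b (c + of_nat m))) \<longlonglongrightarrow> (\<Sum>k. if k = 0 then 1 else 0)"
    using tannerys_theorem[OF hyp2F1_coeff_shift_LIMSEQ] by simp
  thus ?thesis using sums_single[of 0 "\<lambda>_. 1 :: complex"] by (simp add: sums_iff)
qed

theorem Gauss_hypergeometric_sum:
  assumes c: "c \<notin> \<int>\<^sub>\<le>\<^sub>0" and abc: "Re (c - a - b) > 0"
  shows "hyp2F1_coeff a b c sums (Gamma c * Gamma (c - a - b) * rGamma (c - a) * rGamma (c - b))"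
proof -
  define P where "P = (\<lambda>n. pochhammer (c - a) n * pochhammer (c - b) n /
                             (pochhammer c n * pochhammer (c - a - b) n))"
  have "(\<lambda>n. (pochhammer (c - a) n / pochhammer c n * of_nat n powr (c - (c - a))) *
             (pochhammer (c - b) n / pochhammer (c - a - b) n * of_nat n powr (c - a - b - (c - b)))) \<longlonglongrightarrow>
          rGamma (c - a) * Gamma c * (rGamma (c - b) * Gamma (c - a - b))"
    by (intro tendsto_mult pochhammer_ratio_LIMSEQ)
  moreover have "\<forall>\<^sub>F n in sequentially.
      (pochhammer (c - a) n / pochhammer c n * of_nat n powr (c - (c - a))) *
      (pochhammer (c - b) n / pochhammer (c - a - b) n * of_nat n powr (c - a - b - (c - b))) = P n"
    using eventually_gt_at_top[of 0] by eventually_elim (simp add: P_def powr_minus)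
  ultimately have "P \<longlonglongrightarrow> rGamma (c - a) * Gamma c * (rGamma (c - b) * Gamma (c - a - b))"
    by (rule Lim_transform_eventually)
  hence "(\<lambda>n. P n * suminf (hyp2F1_coeff a b (c + of_nat n))) \<longlonglongrightarrow>
           rGamma (c - a) * Gamma c * (rGamma (c - b) * Gamma (c - a - b)) * 1"
    by (intro tendsto_mult suminf_hyp2F1_coeff_shift_LIMSEQ abc)
  hence "suminf (hyp2F1_coeff a b c) = rGamma (c - a) * Gamma c * (rGamma (c - b) * Gamma (c - a - b))"
    unfolding P_def suminf_hyp2F1_coeff_increase_lower_param_iterate[OF c abc, symmetric]
    by (simp add: LIMSEQ_const_iff)
  thus ?thesis
    using summable_norm_cancel[OF summable_norm_hyp2F1_coeff[OF abc]] by (simp add: sums_iff mult_ac)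
qed

section \<open>Analytic continuation of the hypergeometric series\<close>

definition fps_2F1 :: "complex \<Rightarrow> complex \<Rightarrow> complex \<Rightarrow> complex fps" where
  "fps_2F1 a b c = Abs_fps (hyp2F1_coeff a b c)"

lemma fps_2F1_nth [simp]: "fps_2F1 a b c $ n = hyp2F1_coeff a b c n"
  by (simp add: fps_2F1_def)

lemma fps_hypergeo_2_1_eq: "fps_hypergeo [a, b] [c] 1 = fps_2F1 a b c"
  by (simp add: fps_eq_iff hyp2F1_coeff_def)

lemma Euler_integral_has_slit_expansion:
  assumes b: "Re b > 0" and cb: "Re (c - b) > 0"
  shows "(\<lambda>z. inverse (Beta b (c - b)) *
            (\<integral>t. Beta_integrand b (c - b) t * (1 - z * of_real t) powr (- a) \<partial>lborel01))
           has_slit_expansion fps_2F1 a b c"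
proof -
  have nonpole: "b \<notin> \<int>\<^sub>\<le>\<^sub>0" "c - b \<notin> \<int>\<^sub>\<le>\<^sub>0" "c \<notin> \<int>\<^sub>\<le>\<^sub>0"
    using b cb by (auto intro!: Re_pos_imp_not_nonpos_Int)
  hence "Beta b (c - b) \<noteq> 0" by (simp add: Beta_def Gamma_eq_zero_iff)
  moreover have "(\<integral>t. Beta_integrand b (c - b) t * of_real t ^ n \<partial>lborel01) =
                   Beta b (c - b) * (pochhammer b n / pochhammer c n)" for n
    using has_bochner_integral_Beta_moment[OF b cb, of n] Beta_add_of_nat[of b "c - b" n] nonpole
    by (simp add: has_bochner_integral_iff)
  ultimately have fps_eq: "fps_2F1 a b c = fps_const (inverse (Beta b (c - b))) *
      Abs_fps (\<lambda>n. pochhammer a n / fact n * (\<integral>t. Beta_integrand b (c - b) t * of_real t ^ n \<partial>lborel01))"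
    by (simp add: fps_eq_iff hyp2F1_coeff_def field_simps)
  show ?thesis
    unfolding fps_eq using b cb
    by (intro has_slit_expansion_cmult_left has_slit_expansion_slit_kernel
          measurable_ident_lborel01 integrable_Beta_integrand) (auto simp: space_lborel01)
qed

lemma fps_2F1_decrease_lower_param:
  assumes c: "c \<notin> \<int>\<^sub>\<le>\<^sub>0"
  shows "fps_2F1 a b c =
           fps_2F1 a b (c + 1) + fps_const (1 / c) * (fps_X * fps_deriv (fps_2F1 a b (c + 1)))"
proof (rule fps_ext)
  fix n
  have "c \<noteq> 0" using c by auto
  hence "1 + of_nat n / c = (c + of_nat n) / c" by (simp add: field_simps)
  hence "hyp2F1_coeff a b c n = hyp2F1_coeff a b (c + 1) n * (1 + of_nat n / c)"
    using \<open>c \<noteq> 0\<close> add_of_nat_nonzero[OF c, of n] by (simp add: hyp2F1_coeff_increase_lower_param[OF c])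
  thus "fps_2F1 a b c $ n =
          (fps_2F1 a b (c + 1) + fps_const (1 / c) * (fps_X * fps_deriv (fps_2F1 a b (c + 1)))) $ n"
    by (cases n) (simp_all add: algebra_simps add_divide_distrib)
qed

lemma has_slit_expansion_decrease_lower_param:
  assumes f: "f has_slit_expansion fps_2F1 a b (c + 1)" and c: "c \<notin> \<int>\<^sub>\<le>\<^sub>0"
  shows "(\<lambda>z. f z + 1 / c * (z * deriv f z)) has_slit_expansion fps_2F1 a b c"
  unfolding has_slit_expansion_def fps_2F1_decrease_lower_param[OF c]
  using has_slit_expansionD[OF f] open_slit_plane
  by (intro conjI holomorphic_intros fps_expansion_intros) auto

lemma fps_2F1_decrease_upper_param:
  assumes c: "c \<notin> \<int>\<^sub>\<le>\<^sub>0"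
  shows "fps_const (c - b - 1) * fps_2F1 a b c =
           fps_X * (1 - fps_X) * fps_deriv (fps_2F1 a (b + 1) c) +
           (fps_const (c - b - 1) - fps_const a * fps_X) * fps_2F1 a (b + 1) c"
proof (rule fps_ext)
  fix n
  let ?F = "fps_2F1 a (b + 1) c"
  have rhs_expand: "fps_X * (1 - fps_X) * fps_deriv ?F + (fps_const (c - b - 1) - fps_const a * fps_X) * ?F =
     fps_X * fps_deriv ?F - fps_X * (fps_X * fps_deriv ?F) + fps_const (c - b - 1) * ?F -
     fps_const a * (fps_X * ?F)"
    by (simp add: algebra_simps)
  show "(fps_const (c - b - 1) * fps_2F1 a b c) $ n =
          (fps_X * (1 - fps_X) * fps_deriv ?F + (fps_const (c - b - 1) - fps_const a * fps_X) * ?F) $ n"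
  proof (cases n)
    case (Suc m)
    define M u where "M = (of_nat m :: complex)" and "u = hyp2F1_coeff a (b + 1) c m"
    have nonzero: "c + M \<noteq> 0" "1 + M \<noteq> 0"
      using add_of_nat_nonzero[OF c, of m] of_nat_neq_0[of m, where ?'a = complex]
      by (simp_all add: M_def)
    have "hyp2F1_coeff a b c (Suc m) = u * ((a + M) * b / ((c + M) * (1 + M)))"
      unfolding hyp2F1_coeff_def u_def M_def
        pochhammer_rec[of b] pochhammer_Suc[of a] pochhammer_Suc[of c]
      by (simp add: mult_ac)
    moreover have "hyp2F1_coeff a (b + 1) c (Suc m) = u * ((a + M) * (b + 1 + M) / ((c + M) * (1 + M)))"
      by (simp add: hyp2F1_coeff_Suc u_def M_def)
    moreover have "(c - b - 1) * ((a + M) * b / ((c + M) * (1 + M))) =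
                     (M + c - b) * ((a + M) * (b + 1 + M) / ((c + M) * (1 + M))) - (M + a)"
      using nonzero by (simp add: divide_simps) algebra
    ultimately have "(c - b - 1) * hyp2F1_coeff a b c (Suc m) =
                       (M + c - b) * hyp2F1_coeff a (b + 1) c (Suc m) - (M + a) * u"
      by algebra
    thus ?thesis unfolding rhs_expand Suc by (cases m) (simp_all add: M_def u_def algebra_simps)
  qed simp
qed

lemma has_slit_expansion_decrease_upper_param:
  assumes f: "f has_slit_expansion fps_2F1 a (b + 1) c" and c: "c \<notin> \<int>\<^sub>\<le>\<^sub>0" "c \<noteq> b + 1"
  shows "(\<lambda>z. 1 / (c - b - 1) * (z * (1 - z) * deriv f z + ((c - b - 1) - a * z) * f z))
           has_slit_expansion fps_2F1 a b c"
proof -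
  have "c - b - 1 \<noteq> 0" using c(2) by (auto simp: algebra_simps)
  hence "fps_2F1 a b c = fps_const (1 / (c - b - 1)) * (fps_const (c - b - 1) * fps_2F1 a b c)"
    by (simp add: fps_eq_iff)
  also note fps_2F1_decrease_upper_param[OF c(1)]
  finally have fps_eq: "fps_2F1 a b c = fps_const (1 / (c - b - 1)) *
      (fps_X * (1 - fps_X) * fps_deriv (fps_2F1 a (b + 1) c) +
       (fps_const (c - b - 1) - fps_const a * fps_X) * fps_2F1 a (b + 1) c)" .
  show ?thesis
    unfolding has_slit_expansion_def
    by (subst fps_eq, use has_slit_expansionD[OF f] open_slit_plane in
        \<open>intro conjI holomorphic_intros fps_expansion_intros\<close>) auto
qed

text \<open>Euler's integral covers \<open>0 < Re b < Re c\<close>; one contiguity relation then lowers \<open>b\<close>, another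
  one \<open>c\<close>.\<close>

lemma fps_2F1_expansion_exists_Re_gt_1:
  assumes c: "Re c > 1" and bc: "Re b < Re c"
  shows "\<exists>f. f has_slit_expansion fps_2F1 a b c"
proof -
  have exists: "\<exists>f. f has_slit_expansion fps_2F1 a b c" if "Re b < Re c" "Re b > - real k" for k b
    using that
  proof (induction k arbitrary: b)
    case 0
    thus ?case using Euler_integral_has_slit_expansion[of b c a] by auto
  next
    case (Suc k)
    show ?case
    proof (cases "Re b > 0")
      case True
      thus ?thesis using Euler_integral_has_slit_expansion[of b c a] Suc.prems by auto
    next
      case False
      then obtain f where "f has_slit_expansion fps_2F1 a (b + 1) c"
        using Suc.IH[of "b + 1"] Suc.prems c by auto
      moreover have "c \<notin> \<int>\<^sub>\<le>\<^sub>0" "c \<noteq> b + 1"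
        using False c by (auto intro!: Re_pos_imp_not_nonpos_Int)
      ultimately show ?thesis using has_slit_expansion_decrease_upper_param by blast
    qed
  qed
  obtain k where "real k > - Re b" using reals_Archimedean2 by blast
  thus ?thesis using exists[of b k] bc by simp
qed

lemma fps_2F1_expansion_exists:
  assumes c: "c \<notin> \<int>\<^sub>\<le>\<^sub>0"
  shows "\<exists>f. f has_slit_expansion fps_2F1 a b c"
proof -
  have "\<exists>f. f has_slit_expansion fps_2F1 a b c"
    if "f has_slit_expansion fps_2F1 a b (c + of_nat k)" for k f
    using that
  proof (induction k arbitrary: f)
    case (Suc k)
    have "f has_slit_expansion fps_2F1 a b (c + of_nat k + 1)" using Suc.prems by (simp add: add_ac)
    from has_slit_expansion_decrease_lower_param[OF this] show ?case
      using Suc.IH not_nonpos_Int_add_of_nat[OF c] by blast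
  qed auto
  moreover obtain k where "real k > max 1 (Re b) - Re c" using reals_Archimedean2 by blast
  hence "\<exists>f. f has_slit_expansion fps_2F1 a b (c + of_nat k)"
    by (intro fps_2F1_expansion_exists_Re_gt_1) auto
  ultimately show ?thesis by blast
qed

theorem hyp2F1_has_slit_expansion:
  assumes c: "c \<notin> \<int>\<^sub>\<le>\<^sub>0"
  shows "hyp2F1 a b c has_slit_expansion fps_2F1 a b c"
proof -
  obtain f where f: "f has_slit_expansion fps_2F1 a b c" using fps_2F1_expansion_exists[OF c] by blast
  note f = has_slit_expansionD[OF f]
  have "f holomorphic_on ball 0 1" using f(1) ball_subset_slit_plane holomorphic_on_subset by blast
  hence "is_hyp2F1_continuation a b c f"
    using f(1) has_fps_expansion_imp_eval_fps_eq[OF f(2)]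
    by (auto simp: is_hyp2F1_continuation_def slit_plane_def fps_hypergeo_2_1_eq)
  hence continuation: "is_hyp2F1_continuation a b c (hyp2F1 a b c)"
    unfolding hyp2F1_def by (rule someI[where P = "is_hyp2F1_continuation a b c"])
  have "\<forall>\<^sub>F z in nhds (0::complex). z \<in> ball 0 1" by (rule eventually_nhds_in_open) auto
  hence "\<forall>\<^sub>F z in nhds 0. eval_fps (fps_2F1 a b c) z = hyp2F1 a b c z"
    by eventually_elim (use continuation in \<open>auto simp: is_hyp2F1_continuation_def fps_hypergeo_2_1_eq\<close>)
  thus ?thesis using continuation f(2)
    by (auto simp: has_slit_expansion_def has_fps_expansion_def is_hyp2F1_continuation_def slit_plane_def)
qed

lemma hyp2F1_commute: "hyp2F1 a b c = hyp2F1 b a c"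
  by (simp add: hyp2F1_def is_hyp2F1_continuation_def fps_hypergeo_2_1_eq fps_2F1_def
      hyp2F1_coeff_commute[of a])

lemma
  assumes c: "c \<notin> \<int>\<^sub>\<le>\<^sub>0" and z: "norm z < 1"
  shows hyp2F1_eq_suminf: "hyp2F1 a b c z = (\<Sum>n. hyp2F1_coeff a b c n * z ^ n)"
    and summable_norm_hyp2F1: "summable (\<lambda>n. norm (hyp2F1_coeff a b c n * z ^ n))"
proof -
  note F = has_slit_expansionD[OF hyp2F1_has_slit_expansion[OF c, of a b]]
  have holo: "hyp2F1 a b c holomorphic_on ball 0 1"
    using F(1) ball_subset_slit_plane by (rule holomorphic_on_subset)
  show "hyp2F1 a b c z = (\<Sum>n. hyp2F1_coeff a b c n * z ^ n)"
    using has_fps_expansion_imp_eval_fps_eq[OF F(2) z holo] by (simp add: eval_fps_def)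
  have "fps_conv_radius (fps_2F1 a b c) \<ge> 1"
    using holo by (intro holomorphic_on_imp_fps_conv_radius_ge[OF F(2)])
      (simp add: eball_def ball_def one_ereal_def)
  thus "summable (\<lambda>n. norm (hyp2F1_coeff a b c n * z ^ n))"
    using z abs_summable_in_conv_radius[of z "hyp2F1_coeff a b c"] less_le_trans[of "ereal (norm z)" 1]
    by (simp add: fps_conv_radius_def)
qed

section \<open>Pfaff's transformation\<close>

lemma has_fps_expansion_one_minus_powr:
  "(\<lambda>z. (1 - z) powr (- s)) has_fps_expansion fps_hypergeo [s] [] 1" for s :: complex
  by (rule has_fps_expansion_unit_discI) (use sums_one_minus_powr in auto)

lemma fps_hypergeo_1_0_mult:
  "fps_hypergeo [s] [] 1 * fps_hypergeo [t] [] 1 = fps_hypergeo [s + t] [] (1 :: complex)"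
proof (rule fps_expansion_unique_complex)
  show "(\<lambda>z. (1 - z) powr (- (s + t))) has_fps_expansion fps_hypergeo [s] [] 1 * fps_hypergeo [t] [] 1"
    using has_fps_expansion_mult[OF has_fps_expansion_one_minus_powr has_fps_expansion_one_minus_powr, of s t]
    by (simp flip: powr_add)
qed (rule has_fps_expansion_one_minus_powr)

lemma fps_hypergeo_1_0_power:
  "fps_hypergeo [1] [] 1 ^ n = fps_hypergeo [of_nat n] [] (1 :: complex)"
proof (induction n)
  case 0
  show ?case by (auto simp: fps_eq_iff pochhammer_0_left)
qed (simp add: fps_hypergeo_1_0_mult add.commute del: fps_hypergeo_1_0)

lemma fps_mult_compose_nth:
  fixes A F G :: "'a :: comm_ring_1 fps"
  assumes G: "G $ 0 = 0"
  shows "(A * (F oo G)) $ n = (\<Sum>i\<le>n. F $ i * (A * G ^ i) $ n)"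
proof -
  have "(A * (F oo G)) $ n = (\<Sum>j\<le>n. A $ j * (\<Sum>i\<le>n. F $ i * (G ^ i) $ (n - j)))"
    unfolding fps_mult_nth atLeast0AtMost fps_compose_nth
    by (intro sum.cong refl arg_cong2[where f = "(*)"] sum.mono_neutral_left)
       (use startsby_zero_power_prefix[OF G] in auto)
  also have "\<dots> = (\<Sum>i\<le>n. \<Sum>j\<le>n. A $ j * (F $ i * (G ^ i) $ (n - j)))"
    unfolding sum_distrib_left by (rule sum.swap)
  also have "\<dots> = (\<Sum>i\<le>n. F $ i * (A * G ^ i) $ n)"
    unfolding fps_mult_nth atLeast0AtMost sum_distrib_left by (simp add: mult_ac)
  finally show ?thesis .
qed

definition fps_Pfaff :: "complex fps" where
  "fps_Pfaff = - (fps_X * fps_hypergeo [1] [] 1)"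

lemma has_fps_expansion_Pfaff: "(\<lambda>z. z / (z - 1)) has_fps_expansion fps_Pfaff"
proof -
  have "(\<lambda>z. - (z * (1 - z) powr (- 1))) has_fps_expansion fps_Pfaff"
    unfolding fps_Pfaff_def by (intro fps_expansion_intros has_fps_expansion_one_minus_powr)
  also have "(\<lambda>z::complex. - (z * (1 - z) powr (- 1))) = (\<lambda>z. z / (z - 1))"
  proof
    fix z :: complex
    show "- (z * (1 - z) powr (- 1)) = z / (z - 1)"
      by (cases "z = 1") (auto simp: powr_minus field_simps)
  qed
  finally show ?thesis .
qed

lemma fps_Pfaff_power_nth:
  assumes "i \<le> n"
  shows "(fps_hypergeo [b] [] 1 * fps_Pfaff ^ i) $ n =
           pochhammer (b + of_nat i) (n - i) * pochhammer (- of_nat n) i / fact n"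
proof -
  have "fps_Pfaff ^ i = fps_const ((-1) ^ i) * (fps_X ^ i * fps_hypergeo [of_nat i] [] 1)"
    unfolding fps_Pfaff_def power_minus[of "fps_X * _"] power_mult_distrib fps_hypergeo_1_0_power
    by (simp add: fps_const_power[symmetric] fps_const_neg[symmetric] del: fps_const_neg fps_const_power)
  hence "fps_hypergeo [b] [] 1 * fps_Pfaff ^ i =
           fps_const ((-1) ^ i) * (fps_X ^ i * fps_hypergeo [b + of_nat i] [] 1)"
    by (simp only: fps_hypergeo_1_0_mult[symmetric] mult_ac)
  hence "(fps_hypergeo [b] [] 1 * fps_Pfaff ^ i) $ n =
           pochhammer (b + of_nat i) (n - i) * ((-1) ^ i / fact (n - i))"
    using assms by (simp add: fps_X_power_mult_nth)
  moreover have "(-1) ^ i / fact (n - i) = (pochhammer (- of_nat n) i / fact n :: complex)"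
  proof -
    have "of_nat (n choose i) = (-1) ^ i * pochhammer (- of_nat n) i / (fact i :: complex)"
      by (simp add: binomial_gbinomial gbinomial_pochhammer)
    hence "(-1) ^ i * (pochhammer (- of_nat n) i * fact (n - i)) = (fact n :: complex)"
      using assms by (simp add: binomial_fact field_simps)
    hence "pochhammer (- of_nat n) i * fact (n - i) = (-1) ^ i * (fact n :: complex)"
      by (metis left_minus_one_mult_self)
    thus ?thesis by (simp add: field_simps)
  qed
  ultimately show ?thesis by simp
qed

lemma fps_2F1_Pfaff:
  assumes c: "c \<notin> \<int>\<^sub>\<le>\<^sub>0"
  shows "fps_hypergeo [b] [] 1 * (fps_2F1 (c - a) b c oo fps_Pfaff) = fps_2F1 a b c"
proof (rule fps_ext)
  fix n
  have summand: "hyp2F1_coeff (c - a) b c i * (fps_hypergeo [b] [] 1 * fps_Pfaff ^ i) $ n =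
      pochhammer b n / fact n *
        (pochhammer (c - a) i * pochhammer (- of_nat n) i / (of_nat (fact i) * pochhammer c i))"
    if "i \<le> n" for i
    unfolding fps_Pfaff_power_nth[OF that] hyp2F1_coeff_def pochhammer_product[OF that, of b]
    by (simp add: mult_ac)
  have "(fps_hypergeo [b] [] 1 * (fps_2F1 (c - a) b c oo fps_Pfaff)) $ n =
     (\<Sum>i\<le>n. hyp2F1_coeff (c - a) b c i * (fps_hypergeo [b] [] 1 * fps_Pfaff ^ i) $ n)"
    by (subst fps_mult_compose_nth) (simp_all add: fps_Pfaff_def)
  also have "\<dots> = pochhammer b n / fact n *
     (\<Sum>i=0..n. pochhammer (c - a) i * pochhammer (- of_nat n) i / (of_nat (fact i) * pochhammer c i))"
    unfolding sum_distrib_left atLeast0AtMost by (intro sum.cong refl summand) auto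
  also have "\<dots> = pochhammer b n / fact n * (pochhammer (c - (c - a)) n / pochhammer c n)"
    by (subst Vandermonde_pochhammer) (use c in auto)
  also have "\<dots> = fps_2F1 a b c $ n" by (simp add: hyp2F1_coeff_def mult_ac)
  finally show "(fps_hypergeo [b] [] 1 * (fps_2F1 (c - a) b c oo fps_Pfaff)) $ n = fps_2F1 a b c $ n" .
qed

theorem hyp2F1_Pfaff:
  assumes c: "c \<notin> \<int>\<^sub>\<le>\<^sub>0" and z: "z \<in> slit_plane"
  shows "hyp2F1 a b c z = (1 - z) powr (- b) * hyp2F1 (c - a) b c (z / (z - 1))"
proof (rule has_slit_expansion_unique[OF hyp2F1_has_slit_expansion[OF c] _ z])
  note F = has_slit_expansionD[OF hyp2F1_has_slit_expansion[OF c, of "c - a" b]]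
  have "z \<noteq> 1" if "z \<in> slit_plane" for z using that by (auto simp: mem_slit_plane_iff)
  hence "(hyp2F1 (c - a) b c \<circ> (\<lambda>z. z / (z - 1))) holomorphic_on slit_plane"
    using slit_plane_Pfaff by (intro holomorphic_on_compose_gen[OF _ F(1)] holomorphic_intros) auto
  moreover have "(hyp2F1 (c - a) b c \<circ> (\<lambda>z. z / (z - 1))) has_fps_expansion
                   (fps_2F1 (c - a) b c oo fps_Pfaff)"
    by (intro has_fps_expansion_compose F has_fps_expansion_Pfaff) (simp add: fps_Pfaff_def)
  ultimately show "(\<lambda>z. (1 - z) powr (- b) * hyp2F1 (c - a) b c (z / (z - 1)))
                     has_slit_expansion fps_2F1 a b c"
    unfolding has_slit_expansion_def fps_2F1_Pfaff[OF c, of b a, symmetric]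
    using one_minus_slit_plane
    by (intro conjI holomorphic_intros has_fps_expansion_mult has_fps_expansion_one_minus_powr)
       (auto simp: o_def)
qed

section \<open>Beta integrals of hypergeometric functions\<close>

lemma summable_norm_hyp2F1_coeff_mult_Beta:
  fixes x y :: real
  assumes xy: "x > 0" "y > 0" and abc: "Re (a + b - c) < y"
  shows "summable (\<lambda>n. norm (hyp2F1_coeff a b c n) * Beta (x + real n) y)"
proof -
  define ratio where "ratio = (\<lambda>n. pochhammer (complex_of_real x) n / pochhammer (of_real (x + y)) n)"
  have "(\<lambda>n. ratio n * of_nat n powr (- of_real (- y))) \<longlonglongrightarrow> rGamma (of_real x) * Gamma (of_real (x + y))"
    using pochhammer_ratio_LIMSEQ[of "of_real x" "of_real (x + y)"] by (simp add: ratio_def)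
  hence ratio_bigo: "(\<lambda>n. norm (ratio n)) \<in> O(\<lambda>n. real n powr (- y))"
    using norm_in_bigo_powr_Re[of ratio] by fastforce
  have "summable (\<lambda>n. norm (hyp2F1_coeff a b c n) * norm (ratio n))"
  proof (rule summable_comparison_test_bigo)
    show "(\<lambda>n. norm (hyp2F1_coeff a b c n) * norm (ratio n)) \<in>
            O(\<lambda>n. real n powr (Re (a + b - c) - 1) * real n powr (- y))"
      by (rule landau_o.big.mult[OF norm_hyp2F1_coeff_bigo ratio_bigo])
    show "summable (\<lambda>n. norm (real n powr (Re (a + b - c) - 1) * real n powr (- y)))"
      using abc by (simp add: summable_real_powr_iff flip: powr_add)
  qed
  hence "summable (\<lambda>n. norm (hyp2F1_coeff a b c n) * norm (ratio n) * Beta x y)"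
    by (rule summable_mult2)
  moreover have "Beta (x + real n) y = norm (ratio n) * Beta x y" for n
  proof -
    have "x \<notin> \<int>\<^sub>\<le>\<^sub>0" "x + y \<notin> \<int>\<^sub>\<le>\<^sub>0" using xy by (auto elim!: nonpos_Ints_cases)
    moreover have "pochhammer x n > 0" "pochhammer (x + y) n > 0"
      using xy by (auto intro!: pochhammer_pos)
    ultimately show ?thesis
      unfolding ratio_def pochhammer_of_real norm_divide norm_of_real by (simp add: Beta_add_of_nat)
  qed
  ultimately show ?thesis by (simp add: mult.assoc)
qed

lemma sums_hyp2F1_coeff_mult_Beta:
  assumes c: "c \<notin> \<int>\<^sub>\<le>\<^sub>0" and cs: "c + s \<notin> \<int>\<^sub>\<le>\<^sub>0" and abc: "Re (c + s - a - b) > 0"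
  shows "(\<lambda>n. hyp2F1_coeff a b c n * Beta (c + of_nat n) s) sums
           (Gamma c * Gamma s * Gamma (c + s - a - b) * rGamma (c + s - a) * rGamma (c + s - b))"
proof -
  have "(\<lambda>n. Beta c s * hyp2F1_coeff a b (c + s) n) sums
          (Beta c s * (Gamma (c + s) * Gamma (c + s - a - b) * rGamma (c + s - a) * rGamma (c + s - b)))"
    by (intro sums_mult Gauss_hypergeometric_sum cs abc)
  also have "(\<lambda>n. Beta c s * hyp2F1_coeff a b (c + s) n) =
               (\<lambda>n. hyp2F1_coeff a b c n * Beta (c + of_nat n) s)"
    using pochhammer_nonzero[OF c]
    by (simp add: Beta_add_of_nat[OF c cs] hyp2F1_coeff_def fun_eq_iff mult_ac)
  also have "Beta c s *
      (Gamma (c + s) * Gamma (c + s - a - b) * rGamma (c + s - a) * rGamma (c + s - b)) =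
      Gamma c * Gamma s * Gamma (c + s - a - b) * rGamma (c + s - a) * rGamma (c + s - b)"
    using cs by (simp add: Beta_def Gamma_eq_zero_iff)
  finally show ?thesis .
qed

theorem has_bochner_integral_Beta_hyp2F1:
  assumes c: "Re c > 0" and s: "Re s > 0" and abc: "Re (c + s - a - b) > 0"
  shows "has_bochner_integral lborel01
     (\<lambda>t. Beta_integrand c s t * hyp2F1 a b c (of_real t))
     (Gamma c * Gamma s * Gamma (c + s - a - b) * rGamma (c + s - a) * rGamma (c + s - b))"
    (is "has_bochner_integral _ _ ?I")
proof -
  have nonpole: "c \<notin> \<int>\<^sub>\<le>\<^sub>0" "c + s \<notin> \<int>\<^sub>\<le>\<^sub>0" using c s by (auto intro!: Re_pos_imp_not_nonpos_Int)
  note moment = has_bochner_integral_Beta_moment[OF c s]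
  have int: "integrable lborel01 (\<lambda>t. Beta_integrand c s t * of_real t ^ n)" for n
    using moment by (simp add: has_bochner_integral_iff)
  have conv: "summable (\<lambda>n. norm (hyp2F1_coeff a b c n * of_real t ^ n))" if "t \<in> space lborel01" for t
    using that by (intro summable_norm_hyp2F1 nonpole) (auto simp: space_lborel01)
  have summable: "summable (\<lambda>n. norm (hyp2F1_coeff a b c n) *
                    (\<integral>t. norm (Beta_integrand c s t * of_real t ^ n) \<partial>lborel01))"
    unfolding integral_norm_Beta_moment[OF c s]
    using c s abc by (intro summable_norm_hyp2F1_coeff_mult_Beta) auto
  have "integrable lborel01 (\<lambda>t. Beta_integrand c s t * (\<Sum>n. hyp2F1_coeff a b c n * of_real t ^ n))"
    using int conv summable by (rule integrable_mult_powser)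
  moreover have "(\<integral>t. Beta_integrand c s t * (\<Sum>n. hyp2F1_coeff a b c n * of_real t ^ n) \<partial>lborel01) = ?I"
    using sums_integral_mult_powser[OF int conv summable]
      sums_hyp2F1_coeff_mult_Beta[OF nonpole abc] moment
    by (simp add: has_bochner_integral_iff sums_unique2)
  ultimately have "has_bochner_integral lborel01
      (\<lambda>t. Beta_integrand c s t * (\<Sum>n. hyp2F1_coeff a b c n * of_real t ^ n)) ?I"
    by (simp add: has_bochner_integral_iff)
  also have "?this \<longleftrightarrow> ?thesis"
    using nonpole
    by (intro has_bochner_integral_cong) (auto simp: hyp2F1_eq_suminf space_lborel01)
  finally show ?thesis .
qed

definition hyp2F1_weight :: "complex \<Rightarrow> complex \<Rightarrow> complex \<Rightarrow> complex \<Rightarrow> real \<Rightarrow> complex" where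
  "hyp2F1_weight a b c s t = Beta_integrand s c t * hyp2F1 a b c (of_real (1 - t))"

lemma has_bochner_integral_hyp2F1_weight_moment:
  assumes c: "Re c > 0" and s: "Re s > 0" and abc: "Re (c + s - a - b) > 0"
  shows "has_bochner_integral lborel01 (\<lambda>t. hyp2F1_weight a b c s t * of_real t ^ n)
     (Gamma c * Gamma (s + of_nat n) * Gamma (c + s - a - b + of_nat n) *
        rGamma (c + s - a + of_nat n) * rGamma (c + s - b + of_nat n))"
proof -
  have "has_bochner_integral lborel01
     (\<lambda>t. Beta_integrand c (s + of_nat n) t * hyp2F1 a b c (of_real t))
     (Gamma c * Gamma (s + of_nat n) * Gamma (c + (s + of_nat n) - a - b) *
        rGamma (c + (s + of_nat n) - a) * rGamma (c + (s + of_nat n) - b))"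
    using c s abc by (intro has_bochner_integral_Beta_hyp2F1) auto
  note has_bochner_integral_lborel01_reflect[OF this]
  moreover have "c + (s + of_nat n) - a - b = c + s - a - b + of_nat n"
    "c + (s + of_nat n) - a = c + s - a + of_nat n" "c + (s + of_nat n) - b = c + s - b + of_nat n"
    by simp_all
  ultimately have "has_bochner_integral lborel01
     (\<lambda>t. Beta_integrand (s + of_nat n) c t * hyp2F1 a b c (of_real (1 - t)))
     (Gamma c * Gamma (s + of_nat n) * Gamma (c + s - a - b + of_nat n) *
        rGamma (c + s - a + of_nat n) * rGamma (c + s - b + of_nat n))"
    by (simp only: Beta_integrand_reflect)
  also have "?this \<longleftrightarrow> ?thesis"
    by (intro has_bochner_integral_cong)
       (auto simp: hyp2F1_weight_def space_lborel01 simp flip: Beta_integrand_mult_power)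
  finally show ?thesis .
qed

lemma Gamma_add_of_nat:
  "u \<notin> \<int>\<^sub>\<le>\<^sub>0 \<Longrightarrow> Gamma (u + of_nat n) = pochhammer u n * Gamma u" for u :: complex
  by (simp add: pochhammer_Gamma Gamma_eq_zero_iff)

lemma rGamma_add_of_nat:
  "u \<notin> \<int>\<^sub>\<le>\<^sub>0 \<Longrightarrow> rGamma (u + of_nat n) = rGamma u / pochhammer u n" for u :: complex
  using pochhammer_rGamma[of u n] pochhammer_nonzero[of u n] by simp

theorem has_bochner_integral_hyp2F1_weight_kernel:
  assumes c: "Re c > 0" and s: "Re s > 0" and abc: "Re (c + s - a - b) > 0"
    and csa: "c + s - a \<notin> \<int>\<^sub>\<le>\<^sub>0" and z: "z \<in> slit_plane"
  shows "has_bochner_integral lborel01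
     (\<lambda>t. hyp2F1_weight a b c s t * (1 - z * of_real t) powr (- (c + s - b)))
     (Gamma c * Gamma s * Gamma (c + s - a - b) * rGamma (c + s - a) * rGamma (c + s - b) *
        hyp2F1 (c + s - a - b) s (c + s - a) z)"
proof -
  define K where
    "K = Gamma c * Gamma s * Gamma (c + s - a - b) * rGamma (c + s - a) * rGamma (c + s - b)"
  note moment = has_bochner_integral_hyp2F1_weight_moment[OF c s abc]
  have weight: "integrable lborel01 (hyp2F1_weight a b c s)"
    using moment[of 0] by (simp add: has_bochner_integral_iff)
  have "pochhammer (c + s - b) n / fact n * (\<integral>t. hyp2F1_weight a b c s t * of_real t ^ n \<partial>lborel01) =
          K * hyp2F1_coeff (c + s - a - b) s (c + s - a) n" for n
  proof -
    have "pochhammer (c + s - b) n / fact n * (\<integral>t. hyp2F1_weight a b c s t * of_real t ^ n \<partial>lborel01) =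
       Gamma c * Gamma (s + of_nat n) * Gamma (c + s - a - b + of_nat n) *
         rGamma (c + s - a + of_nat n) * (pochhammer (c + s - b) n * rGamma (c + s - b + of_nat n)) / fact n"
      using moment[of n] by (simp add: has_bochner_integral_iff)
    thus ?thesis
      unfolding pochhammer_rGamma[symmetric] rGamma_add_of_nat[OF csa]
        s[THEN Re_pos_imp_not_nonpos_Int, THEN Gamma_add_of_nat]
        abc[THEN Re_pos_imp_not_nonpos_Int, THEN Gamma_add_of_nat]
      by (simp add: K_def hyp2F1_coeff_def mult_ac)
  qed
  hence fps_eq: "fps_const K * fps_2F1 (c + s - a - b) s (c + s - a) =
      Abs_fps (\<lambda>n. pochhammer (c + s - b) n / fact n *
                 (\<integral>t. hyp2F1_weight a b c s t * of_real t ^ n \<partial>lborel01))"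
    by (simp add: fps_eq_iff)
  have "(\<lambda>z. \<integral>t. hyp2F1_weight a b c s t * (1 - z * of_real t) powr (- (c + s - b)) \<partial>lborel01)
          has_slit_expansion (fps_const K * fps_2F1 (c + s - a - b) s (c + s - a))"
    unfolding fps_eq by (intro has_slit_expansion_slit_kernel measurable_ident_lborel01 weight)
      (auto simp: space_lborel01)
  hence "(\<integral>t. hyp2F1_weight a b c s t * (1 - z * of_real t) powr (- (c + s - b)) \<partial>lborel01) =
           K * hyp2F1 (c + s - a - b) s (c + s - a) z"
    by (rule has_slit_expansion_unique)
       (intro has_slit_expansion_cmult_left hyp2F1_has_slit_expansion csa z)+
  moreover have "integrable lborel01
                   (\<lambda>t. hyp2F1_weight a b c s t * (1 - z * of_real t) powr (- (c + s - b)))"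
    by (intro integrable_slit_kernel measurable_ident_lborel01 weight z) (auto simp: space_lborel01)
  ultimately show ?thesis by (simp add: has_bochner_integral_iff K_def)
qed

section \<open>Solutions at different singular points\<close>

lemma of_real_powr_mult:
  assumes "x > 0" "y > 0"
  shows "complex_of_real (x * y) powr w = of_real x powr w * of_real y powr w"
  using assms unfolding of_real_mult by (intro powr_times_real) auto

lemma of_real_powr_divide:
  assumes "x > 0" "y > 0"
  shows "complex_of_real (x / y) powr w = of_real x powr w * of_real y powr (- w)"
  using assms of_real_powr_mult[of x "inverse y" w]
  by (simp add: powr_def Ln_of_real ln_inverse divide_inverse flip: of_real_inverse)

lemma w1_commute: "w1 x a b c = w1 x b a c"
  by (simp add: w1_def hyp2F1_commute)

lemma w2_commute: "w2 x a b c = w2 x b a c"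
  by (simp add: w2_def hyp2F1_commute)

lemma w3_eq_w4: "w3 x a b c = w4 x b a c"
  by (simp add: w3_def w4_def)

lemma w4_Pfaff:
  assumes ba: "b - a + 1 \<notin> \<int>\<^sub>\<le>\<^sub>0" and x: "x < 0 \<or> x > 1"
  shows "w4 x a b c = of_real \<bar>x\<bar> powr (1 - c) * of_real \<bar>x - 1\<bar> powr (c - b - 1) *
           hyp2F1 (1 - a) (b - c + 1) (b - a + 1) (of_real (1 / (1 - x)))"
proof -
  have pos: "\<bar>x\<bar> > 0" "\<bar>x - 1\<bar> > 0" using x by auto
  have slit: "of_real (inverse x) \<in> slit_plane" using x by (auto simp: mem_slit_plane_iff field_simps)
  have "inverse x / (inverse x - 1) = 1 / (1 - x)" using x by (auto simp: field_simps)
  hence arg: "complex_of_real (inverse x) / (of_real (inverse x) - 1) = of_real (1 / (1 - x))"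
    by (metis of_real_1 of_real_diff of_real_divide)
  have "1 - inverse x = \<bar>x - 1\<bar> / \<bar>x\<bar>" using x by (auto simp: field_simps)
  hence one_minus: "1 - complex_of_real (inverse x) = of_real (\<bar>x - 1\<bar> / \<bar>x\<bar>)"
    by (metis of_real_1 of_real_diff)
  have "hyp2F1 b (b - c + 1) (b - a + 1) (of_real (inverse x)) =
      of_real (\<bar>x - 1\<bar> / \<bar>x\<bar>) powr (- (b - c + 1)) *
        hyp2F1 (1 - a) (b - c + 1) (b - a + 1) (of_real (1 / (1 - x)))"
    using hyp2F1_Pfaff[OF ba slit, of b "b - c + 1"] unfolding arg one_minus by simp
  also have "of_real (\<bar>x - 1\<bar> / \<bar>x\<bar>) powr (- (b - c + 1)) =
      complex_of_real \<bar>x - 1\<bar> powr (c - b - 1) * of_real \<bar>x\<bar> powr (b - c + 1)"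
    unfolding of_real_powr_divide[OF pos(2,1)] by (simp add: algebra_simps)
  finally have "hyp2F1 b (b - c + 1) (b - a + 1) (of_real (inverse x)) =
      of_real \<bar>x - 1\<bar> powr (c - b - 1) * of_real \<bar>x\<bar> powr (b - c + 1) *
        hyp2F1 (1 - a) (b - c + 1) (b - a + 1) (of_real (1 / (1 - x)))" .
  moreover have "complex_of_real \<bar>x\<bar> powr (1 - c) = of_real \<bar>x\<bar> powr (- b) * of_real \<bar>x\<bar> powr (b - c + 1)"
    by (simp flip: powr_add)
  ultimately show ?thesis by (simp add: w4_def)
qed

lemma w3_reciprocal:
  assumes "x > 0"
  shows "w3 (1 / x) a b c = of_real x powr a * w1 x a (a - c + 1) (a - b + 1)"
  using assms of_real_powr_divide[of 1 x "- a"] by (simp add: w3_def w1_def)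

lemma w4_reciprocal:
  assumes "x \<noteq> 0"
  shows "w4 (1 / x) a (a - c + 1) (a - b + 1) = of_real \<bar>x\<bar> powr a * w2 x a b c"
proof -
  have "complex_of_real \<bar>1 / x\<bar> powr (- (a - c + 1)) = of_real \<bar>x\<bar> powr (a - c + 1)"
    using assms of_real_powr_divide[of 1 "\<bar>x\<bar>" "- (a - c + 1)"] by (simp add: algebra_simps)
  also have "\<dots> = of_real \<bar>x\<bar> powr a * of_real \<bar>x\<bar> powr (1 - c)"
    by (simp add: algebra_simps flip: powr_add)
  finally show ?thesis by (simp add: w4_def w2_def algebra_simps)
qed

section \<open>The substitution \<open>y = 1 / u\<close>\<close>

lemma borel_measurable_reciprocal:
  fixes f :: "real \<Rightarrow> 'a :: {real_normed_vector, second_countable_topology}"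
  assumes "(\<lambda>u. f (1 / u) /\<^sub>R u\<^sup>2) \<in> borel_measurable lborel01"
  shows "f \<in> borel_measurable (restrict_space lborel {1<..})"
proof -
  have "(\<lambda>y. 1 / y) \<in> restrict_space borel {1<..} \<rightarrow>\<^sub>M restrict_space borel {0<..<1::real}"
    by (intro measurable_restrict_space3) auto
  from measurable_compose[OF this, of "\<lambda>u. f (1 / u) /\<^sub>R u\<^sup>2" borel] assms
  have measurable_inverse: "(\<lambda>y. f (1 / (1 / y)) /\<^sub>R (1 / y)\<^sup>2) \<in> borel_measurable (restrict_space borel {1<..})"
    by (simp cong: measurable_cong_sets add: sets_restrict_space)
  have "(\<lambda>y. (1 / y)\<^sup>2 *\<^sub>R (f (1 / (1 / y)) /\<^sub>R (1 / y)\<^sup>2))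
          \<in> borel_measurable (restrict_space borel {1<..})"
    by (intro borel_measurable_scaleR measurable_inverse measurable_restrict_space1) measurable
  also have "?this \<longleftrightarrow> f \<in> borel_measurable (restrict_space borel {1<..})"
    by (intro measurable_cong) (auto simp: space_restrict_space)
  finally show ?thesis by (simp cong: measurable_cong_sets add: sets_restrict_space)
qed

lemma has_bochner_integral_reciprocal:
  fixes f :: "real \<Rightarrow> 'a :: euclidean_space"
  assumes "has_bochner_integral lborel01 (\<lambda>u. f (1 / u) /\<^sub>R u\<^sup>2) I"
  shows "has_bochner_integral (restrict_space lborel {1<..}) f I"
proof -
  define h where "h = (\<lambda>u. f (1 / u) /\<^sub>R u\<^sup>2)"
  have h: "set_integrable lborel {0<..<1} h" "set_lebesgue_integral lborel {0<..<1} h = I"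
    using assms by (simp_all add: has_bochner_integral_restrict_lborel_iff h_def)
  have image: "(\<lambda>u. 1 / u) ` {0<..<1::real} = {1<..}"
  proof (intro equalityI subsetI)
    fix y :: real assume "y \<in> {1<..}"
    thus "y \<in> (\<lambda>u. 1 / u) ` {0<..<1}" by (intro image_eqI[of _ _ "1 / y"]) auto
  qed auto
  have "(\<lambda>u. \<bar>- 1 / u\<^sup>2\<bar> *\<^sub>R f (1 / u)) = h" by (simp add: h_def divide_inverse fun_eq_iff)
  moreover have "h absolutely_integrable_on {0<..<1}"
    using h(1) unfolding set_integrable_def by (intro integrable_completion[THEN iffD2]) auto
  moreover have "integral {0<..<1} h = I"
    using h set_borel_integral_eq_integral(2)[OF h(1)] by simp
  moreover have "((\<lambda>u. 1 / u) has_field_derivative - 1 / u\<^sup>2) (at u within {0<..<1})"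
    if "u \<in> {0<..<1}" for u :: real
    using that by (auto intro!: derivative_eq_intros simp: power2_eq_square)
  ultimately have f: "f absolutely_integrable_on {1<..}" "integral {1<..} f = I"
    using has_absolute_integral_change_of_variables_real[of "{0<..<1}" "\<lambda>u. 1 / u" "\<lambda>u. - 1 / u\<^sup>2" f I]
    by (auto simp: image inj_on_def)
  have "f \<in> borel_measurable (restrict_space lborel {1<..})"
    using assms by (intro borel_measurable_reciprocal) (auto simp: has_bochner_integral_iff)
  hence "set_integrable lborel {1<..} f"
    using f(1) unfolding set_integrable_def
    by (subst (asm) integrable_completion) (simp_all add: borel_measurable_restrict_space_iff)
  thus ?thesis
    using f(2) by (simp add: has_bochner_integral_restrict_lborel_iff set_borel_integral_eq_integral(2))
qed

section \<open>The integral transforms\<close>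

definition w1_integrand :: "complex \<Rightarrow> complex \<Rightarrow> complex \<Rightarrow> complex \<Rightarrow> real \<Rightarrow> real \<Rightarrow> complex" where
  "w1_integrand a b c \<mu> x y = of_real y powr (c - 1) * of_real (1 - y) powr (b - c - \<mu>) *
     w1 y a b c * of_real \<bar>x - y\<bar> powr (\<mu> - 1)"

definition w3_integrand :: "complex \<Rightarrow> complex \<Rightarrow> complex \<Rightarrow> complex \<Rightarrow> real \<Rightarrow> real \<Rightarrow> complex" where
  "w3_integrand a b c \<mu> x y = of_real y powr (c - 1) * of_real (y - 1) powr (b - c - \<mu>) *
     w3 y a b c * of_real \<bar>x - y\<bar> powr (\<mu> - 1)"

lemma w1_integrand_eq_weight_kernel:
  assumes x: "x < 0 \<or> x > 1" and y: "0 < y" "y < 1"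
  shows "w1_integrand a b c \<mu> x y = of_real \<bar>x - 1\<bar> powr (\<mu> - 1) *
           (hyp2F1_weight a b c (b - c - \<mu> + 1) (1 - y) *
              (1 - of_real (1 / (1 - x)) * of_real (1 - y)) powr (\<mu> - 1))"
proof -
  define r where "r = 1 - 1 / (1 - x) * (1 - y)"
  have "(x - 1) * (1 / (1 - x)) = - 1" using x by (auto simp: divide_simps)
  hence "x - y = (x - 1) * r" unfolding r_def by algebra
  moreover from this have "r > 0"
    using x y zero_less_mult_iff[of "x - 1" r] mult_less_0_iff[of "x - 1" r] by auto
  ultimately have r: "r > 0" "\<bar>x - y\<bar> = \<bar>x - 1\<bar> * r" by (simp_all add: abs_mult)
  have "complex_of_real \<bar>x - y\<bar> powr (\<mu> - 1) = of_real \<bar>x - 1\<bar> powr (\<mu> - 1) * of_real r powr (\<mu> - 1)"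
    unfolding r(2) using x by (intro of_real_powr_mult r(1)) auto
  moreover have "of_real r = 1 - complex_of_real (1 / (1 - x)) * of_real (1 - y)"
    by (simp add: r_def)
  ultimately show ?thesis
    by (simp add: w1_integrand_def hyp2F1_weight_def Beta_integrand_def w1_def)
qed

lemma w4_raised_params_Pfaff:
  assumes ba: "b - (a + \<mu>) + 1 \<notin> \<int>\<^sub>\<le>\<^sub>0" and x: "x < 0 \<or> x > 1"
  shows "of_real \<bar>x\<bar> powr (c + \<mu> - 1) * of_real \<bar>x - 1\<bar> powr (b - c) * w4 x (a + \<mu>) b (c + \<mu>) =
           of_real \<bar>x - 1\<bar> powr (\<mu> - 1) *
             hyp2F1 (- a - \<mu> + 1) (b - c - \<mu> + 1) (b - a - \<mu> + 1) (of_real (1 / (1 - x)))"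
proof -
  have "complex_of_real \<bar>x\<bar> powr (c + \<mu> - 1) * of_real \<bar>x\<bar> powr (1 - (c + \<mu>)) = 1"
    using x by (auto simp flip: powr_add)
  moreover have "complex_of_real \<bar>x - 1\<bar> powr (b - c) * of_real \<bar>x - 1\<bar> powr (c + \<mu> - b - 1) =
                   of_real \<bar>x - 1\<bar> powr (\<mu> - 1)"
    by (simp add: algebra_simps flip: powr_add)
  ultimately show ?thesis
    unfolding w4_Pfaff[OF ba x, of "c + \<mu>"] by (simp add: algebra_simps)
qed

theorem has_bochner_integral_w1_integrand:
  assumes a\<mu>: "Re (- a - \<mu> + 1) > 0" and bc\<mu>: "Re (b - c - \<mu> + 1) > 0" and c: "Re c > 0"
    and ba\<mu>: "b - (a + \<mu>) + 1 \<notin> \<int>\<^sub>\<le>\<^sub>0" and x: "x < 0 \<or> x > 1"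
  shows "has_bochner_integral lborel01 (w1_integrand a b c \<mu> x)
           (Gamma (- a - \<mu> + 1) * Gamma (b - c - \<mu> + 1) * Gamma c *
             rGamma (b - a - \<mu> + 1) * rGamma (1 - \<mu>) *
             of_real \<bar>x\<bar> powr (c + \<mu> - 1) * of_real \<bar>x - 1\<bar> powr (b - c) *
             w4 x (a + \<mu>) b (c + \<mu>))"
proof -
  define s where "s = b - c - \<mu> + 1"
  define z where "z = complex_of_real (1 / (1 - x))"
  define K where "K = Gamma (- a - \<mu> + 1) * Gamma (b - c - \<mu> + 1) * Gamma c *
                        rGamma (b - a - \<mu> + 1) * rGamma (1 - \<mu>)"
  define H where "H = hyp2F1 (- a - \<mu> + 1) (b - c - \<mu> + 1) (b - a - \<mu> + 1) z"
  define Q where "Q = complex_of_real \<bar>x - 1\<bar> powr (\<mu> - 1)"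
  have params: "c + s - a - b = - a - \<mu> + 1" "c + s - a = b - a - \<mu> + 1" "- (c + s - b) = \<mu> - 1"
      "c + s - b = 1 - \<mu>"
    by (simp_all add: s_def)
  have "z \<in> slit_plane" using x by (auto simp: z_def mem_slit_plane_iff divide_simps)
  moreover have "c + s - a \<notin> \<int>\<^sub>\<le>\<^sub>0" using ba\<mu> by (simp add: params algebra_simps)
  ultimately have "has_bochner_integral lborel01
     (\<lambda>t. hyp2F1_weight a b c s t * (1 - z * of_real t) powr (- (c + s - b)))
     (Gamma c * Gamma s * Gamma (c + s - a - b) * rGamma (c + s - a) * rGamma (c + s - b) *
        hyp2F1 (c + s - a - b) s (c + s - a) z)"
    using a\<mu> bc\<mu> by (intro has_bochner_integral_hyp2F1_weight_kernel c) (simp_all add: s_def)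
  hence "has_bochner_integral lborel01
           (\<lambda>t. hyp2F1_weight a b c s t * (1 - z * of_real t) powr (\<mu> - 1)) (K * H)"
    unfolding params(1,3) unfolding params(2,4) by (simp add: K_def H_def s_def mult_ac)
  from has_bochner_integral_mult_right[OF has_bochner_integral_lborel01_reflect[OF this], of Q]
  have "has_bochner_integral lborel01
     (\<lambda>y. Q * (hyp2F1_weight a b c s (1 - y) * (1 - z * of_real (1 - y)) powr (\<mu> - 1))) (Q * (K * H))" .
  also have "?this \<longleftrightarrow> has_bochner_integral lborel01 (w1_integrand a b c \<mu> x) (K * (Q * H))"
    using w1_integrand_eq_weight_kernel[OF x]
    by (intro has_bochner_integral_cong) (auto simp: space_lborel01 Q_def s_def z_def)
  also have "Q * H = of_real \<bar>x\<bar> powr (c + \<mu> - 1) * of_real \<bar>x - 1\<bar> powr (b - c) * w4 x (a + \<mu>) b (c + \<mu>)"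
    unfolding Q_def H_def z_def by (rule w4_raised_params_Pfaff[OF ba\<mu> x, symmetric])
  finally show ?thesis by (simp only: K_def mult.assoc)
qed

lemma w3_integrand_reciprocal:
  assumes u: "0 < u" "u < 1" and x: "x \<noteq> 0" "x < 1"
  shows "w3_integrand a b c \<mu> x (1 / u) /\<^sub>R u\<^sup>2 =
           of_real \<bar>x\<bar> powr (\<mu> - 1) * w1_integrand a (a - c + 1) (a - b + 1) \<mu> (1 / x) u"
proof -
  define U where "U = (\<lambda>w. complex_of_real u powr w)"
  have U_add: "U v * U w = U (v + w)" for v w by (simp add: U_def powr_add)
  have "u * x < 1"
    using u x mult_strict_mono[of u 1 x 1] mult_pos_neg[of u x] by (cases "x < 0") auto
  hence pos: "\<bar>1 / x - u\<bar> > 0" using x by (auto simp: field_simps)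
  have "\<bar>x - 1 / u\<bar> = \<bar>x\<bar> * \<bar>1 / x - u\<bar> / u"
    using u x by (auto simp: field_simps simp flip: abs_mult)
  hence kernel: "complex_of_real \<bar>x - 1 / u\<bar> powr (\<mu> - 1) =
      of_real \<bar>x\<bar> powr (\<mu> - 1) * of_real \<bar>1 / x - u\<bar> powr (\<mu> - 1) * U (1 - \<mu>)"
    using u x pos
    by (simp add: U_def of_real_powr_divide of_real_powr_mult del: of_real_mult of_real_divide)
  have "1 / u - 1 = (1 - u) / u" using u by (simp add: field_simps)
  hence one_minus: "complex_of_real (1 / u - 1) powr w = of_real (1 - u) powr w * U (- w)" for w
    using u by (simp add: U_def of_real_powr_divide del: of_real_divide)
  have recip: "complex_of_real (1 / u) powr w = U (- w)" for w
    using u of_real_powr_divide[of 1 u] by (simp add: U_def)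
  have "w3_integrand a b c \<mu> x (1 / u) /\<^sub>R u\<^sup>2 =
      (U (1 - c) * U (- (b - c - \<mu>)) * U a * U (1 - \<mu>) * U (- 2)) *
      of_real \<bar>x\<bar> powr (\<mu> - 1) * of_real (1 - u) powr (b - c - \<mu>) *
      w1 u a (a - c + 1) (a - b + 1) * of_real \<bar>1 / x - u\<bar> powr (\<mu> - 1)"
    unfolding w3_integrand_def kernel one_minus recip w3_reciprocal[OF u(1)]
    using u by (simp add: U_def scaleR_conv_of_real powr_minus mult_ac)
  also have "U (1 - c) * U (- (b - c - \<mu>)) * U a * U (1 - \<mu>) * U (- 2) = U (a - b + 1 - 1)"
    by (simp add: U_add)
  finally show ?thesis
    by (simp add: w1_integrand_def U_def mult_ac)
qed

lemma w4_raised_params_reciprocal: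
  assumes x: "x \<noteq> 0" "x \<noteq> 1"
  shows "of_real \<bar>x\<bar> powr (\<mu> - 1) *
           (of_real \<bar>1 / x\<bar> powr (a - b + 1 + \<mu> - 1) * of_real \<bar>1 / x - 1\<bar> powr (b - c) *
             w4 (1 / x) (a + \<mu>) (a - c + 1) (a - b + 1 + \<mu>)) =
         of_real \<bar>x\<bar> powr (c + \<mu> - 1) * of_real \<bar>x - 1\<bar> powr (b - c) * w2 x (a + \<mu>) b (c + \<mu>)"
proof -
  define X where "X = (\<lambda>w. complex_of_real \<bar>x\<bar> powr w)"
  have X_add: "X v * X w = X (v + w)" for v w by (simp add: X_def powr_add)
  have pos: "\<bar>x\<bar> > 0" "\<bar>x - 1\<bar> > 0" using x by auto
  have "1 / x - 1 = (1 - x) / x" using x by (simp add: field_simps)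
  hence "\<bar>1 / x - 1\<bar> = \<bar>x - 1\<bar> / \<bar>x\<bar>" by (simp add: abs_minus_commute)
  hence one_minus: "complex_of_real \<bar>1 / x - 1\<bar> powr w = of_real \<bar>x - 1\<bar> powr w * X (- w)" for w
    using of_real_powr_divide[OF pos(2,1)] by (simp only: X_def)
  have recip: "complex_of_real \<bar>1 / x\<bar> powr w = X (- w)" for w
    using of_real_powr_divide[of 1 "\<bar>x\<bar>"] pos by (simp add: X_def)
  have "w4 (1 / x) (a + \<mu>) (a - c + 1) (a - b + 1 + \<mu>) = X (a + \<mu>) * w2 x (a + \<mu>) b (c + \<mu>)"
    using w4_reciprocal[OF x(1), of "a + \<mu>" "c + \<mu>" b] by (simp add: X_def algebra_simps)
  moreover have "X (\<mu> - 1) * X (- (a - b + 1 + \<mu> - 1)) * X (- (b - c)) * X (a + \<mu>) = X (c + \<mu> - 1)"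
    by (simp add: X_add algebra_simps)
  ultimately show ?thesis unfolding one_minus recip by (simp add: X_def mult_ac)
qed

theorem has_bochner_integral_w3_integrand:
  assumes a\<mu>: "Re (- a - \<mu> + 1) > 0" and bc\<mu>: "Re (b - c - \<mu> + 1) > 0" and ab: "Re (a - b + 1) > 0"
    and c\<mu>: "2 - (c + \<mu>) \<notin> \<int>\<^sub>\<le>\<^sub>0" and x: "x \<noteq> 0" "x < 1"
  shows "has_bochner_integral (restrict_space lborel {1<..}) (w3_integrand a b c \<mu> x)
           (Gamma (- a - \<mu> + 1) * Gamma (b - c - \<mu> + 1) * Gamma (a - b + 1) *
             rGamma (- c - \<mu> + 2) * rGamma (1 - \<mu>) *
             of_real \<bar>x\<bar> powr (c + \<mu> - 1) * of_real \<bar>x - 1\<bar> powr (b - c) *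
             w2 x (a + \<mu>) b (c + \<mu>))"
proof (rule has_bochner_integral_reciprocal)
  define P where "P = complex_of_real \<bar>x\<bar> powr (\<mu> - 1)"
  define K where "K = Gamma (- a - \<mu> + 1) * Gamma (b - c - \<mu> + 1) * Gamma (a - b + 1) *
                        rGamma (- c - \<mu> + 2) * rGamma (1 - \<mu>)"
  define R where "R = of_real \<bar>1 / x\<bar> powr (a - b + 1 + \<mu> - 1) * of_real \<bar>1 / x - 1\<bar> powr (b - c) *
                        w4 (1 / x) (a + \<mu>) (a - c + 1) (a - b + 1 + \<mu>)"
  have params: "a - c + 1 - (a - b + 1) = b - c" "a - c + 1 - a - \<mu> + 1 = - c - \<mu> + 2"
    by simp_all
  have "has_bochner_integral lborel01 (w1_integrand a (a - c + 1) (a - b + 1) \<mu> (1 / x)) (K * R)"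
    unfolding K_def R_def mult.assoc[symmetric] params(1)[symmetric] params(2)[symmetric]
  proof (rule has_bochner_integral_w1_integrand)
    show "1 / x < 0 \<or> 1 / x > 1" using x by (auto simp: divide_simps)
  qed (use a\<mu> bc\<mu> ab c\<mu> in \<open>auto simp: algebra_simps\<close>)
  hence "has_bochner_integral lborel01
           (\<lambda>u. P * w1_integrand a (a - c + 1) (a - b + 1) \<mu> (1 / x) u) (P * (K * R))"
    by (rule has_bochner_integral_mult_right)
  also have "?this \<longleftrightarrow>
      has_bochner_integral lborel01 (\<lambda>u. w3_integrand a b c \<mu> x (1 / u) /\<^sub>R u\<^sup>2) (K * (P * R))"
    using w3_integrand_reciprocal[OF _ _ x]
    by (intro has_bochner_integral_cong) (auto simp: space_lborel01 P_def)
  also have "P * R = of_real \<bar>x\<bar> powr (c + \<mu> - 1) * of_real \<bar>x - 1\<bar> powr (b - c) * w2 x (a + \<mu>) b (c + \<mu>)"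
    unfolding P_def R_def using x by (intro w4_raised_params_reciprocal) auto
  finally show "has_bochner_integral lborel01 (\<lambda>u. w3_integrand a b c \<mu> x (1 / u) /\<^sub>R u\<^sup>2)
      (Gamma (- a - \<mu> + 1) * Gamma (b - c - \<mu> + 1) * Gamma (a - b + 1) *
        rGamma (- c - \<mu> + 2) * rGamma (1 - \<mu>) *
        of_real \<bar>x\<bar> powr (c + \<mu> - 1) * of_real \<bar>x - 1\<bar> powr (b - c) * w2 x (a + \<mu>) b (c + \<mu>))"
    by (simp only: K_def mult.assoc)
qed

lemma has_lebesgue_integral_onI:
  assumes "has_bochner_integral (restrict_space lborel S) f I" "S \<in> sets borel" "\<And>y. y \<in> S \<Longrightarrow> f y = g y"
  shows "has_lebesgue_integral_on g I S"
proof -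
  have "has_bochner_integral (restrict_space lborel S) g I"
    using assms(1) by (rule has_bochner_integral_cong[THEN iffD1, OF refl _ refl, rotated])
      (use assms(3) in \<open>simp add: space_restrict_space\<close>)
  thus ?thesis
    using assms(2) by (simp add: has_lebesgue_integral_on_def has_bochner_integral_restrict_lborel_iff)
qed

theorem mainTheorem10:
  fixes a b c \<mu> :: complex
  shows
    "((Re (- a - \<mu> + 1) > 0 \<and> Re (b - c - \<mu> + 1) > 0 \<and> Re c > 0 \<and>
        c \<notin> \<int>\<^sub>\<le>\<^sub>0 \<and> b - (a + \<mu>) + 1 \<notin> \<int>\<^sub>\<le>\<^sub>0) \<longrightarrow>
      (\<forall>x\<in>({..<0} \<union> {1<..}).
         has_lebesgue_integral_on
           (\<lambda>y. of_real y powr (c - 1) * of_real (1 - y) powr (b - c - \<mu>) *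
                 w1 y a b c * of_real \<bar>x - y\<bar> powr (\<mu> - 1))
           (Gamma (- a - \<mu> + 1) * Gamma (b - c - \<mu> + 1) * Gamma c *
             rGamma (b - a - \<mu> + 1) * rGamma (1 - \<mu>) *
             of_real \<bar>x\<bar> powr (c + \<mu> - 1) * of_real \<bar>x - 1\<bar> powr (b - c) *
             w4 x (a + \<mu>) b (c + \<mu>))
           {0<..<1})) \<and>
     ((Re (- a - \<mu> + 1) > 0 \<and> Re (b - c - \<mu> + 1) > 0 \<and> Re (a - b + 1) > 0 \<and>
        a - b + 1 \<notin> \<int>\<^sub>\<le>\<^sub>0 \<and> 2 - (c + \<mu>) \<notin> \<int>\<^sub>\<le>\<^sub>0) \<longrightarrow>
      (\<forall>x\<in>({..<0} \<union> {0<..<1}).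
         has_lebesgue_integral_on
           (\<lambda>y. of_real y powr (c - 1) * of_real (y - 1) powr (b - c - \<mu>) *
                 w3 y a b c * of_real (y - x) powr (\<mu> - 1))
           (Gamma (- a - \<mu> + 1) * Gamma (b - c - \<mu> + 1) * Gamma (a - b + 1) *
             rGamma (- c - \<mu> + 2) * rGamma (1 - \<mu>) *
             of_real \<bar>x\<bar> powr (c + \<mu> - 1) * of_real \<bar>x - 1\<bar> powr (b - c) *
             w2 x (a + \<mu>) b (c + \<mu>))
           {1<..})) \<and>
     ((Re (- b - \<mu> + 1) > 0 \<and> Re (a - c - \<mu> + 1) > 0 \<and> Re c > 0 \<and>
        c \<notin> \<int>\<^sub>\<le>\<^sub>0 \<and> a - (b + \<mu>) + 1 \<notin> \<int>\<^sub>\<le>\<^sub>0) \<longrightarrow>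
      (\<forall>x\<in>({..<0} \<union> {1<..}).
         has_lebesgue_integral_on
           (\<lambda>y. of_real y powr (c - 1) * of_real (1 - y) powr (a - c - \<mu>) *
                 w1 y a b c * of_real \<bar>x - y\<bar> powr (\<mu> - 1))
           (Gamma (- b - \<mu> + 1) * Gamma (a - c - \<mu> + 1) * Gamma c *
             rGamma (a - b - \<mu> + 1) * rGamma (1 - \<mu>) *
             of_real \<bar>x\<bar> powr (c + \<mu> - 1) * of_real \<bar>x - 1\<bar> powr (a - c) *
             w3 x a (b + \<mu>) (c + \<mu>))
           {0<..<1})) \<and>
     ((Re (- b - \<mu> + 1) > 0 \<and> Re (a - c - \<mu> + 1) > 0 \<and> Re (b - a + 1) > 0 \<and>
        b - a + 1 \<notin> \<int>\<^sub>\<le>\<^sub>0 \<and> 2 - (c + \<mu>) \<notin> \<int>\<^sub>\<le>\<^sub>0) \<longrightarrow>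
      (\<forall>x\<in>({..<0} \<union> {0<..<1}).
         has_lebesgue_integral_on
           (\<lambda>y. of_real y powr (c - 1) * of_real (y - 1) powr (a - c - \<mu>) *
                 w4 y a b c * of_real \<bar>x - y\<bar> powr (\<mu> - 1))
           (Gamma (- b - \<mu> + 1) * Gamma (a - c - \<mu> + 1) * Gamma (b - a + 1) *
             rGamma (- c - \<mu> + 2) * rGamma (1 - \<mu>) *
             of_real \<bar>x\<bar> powr (c + \<mu> - 1) * of_real \<bar>x - 1\<bar> powr (a - c) *
             w2 x a (b + \<mu>) (c + \<mu>))
           {1<..}))"
proof (intro conjI impI ballI, goal_cases)
  case (1 x)
  thus ?case
    by (intro has_lebesgue_integral_onI[OF has_bochner_integral_w1_integrand])
       (auto simp: w1_integrand_def)
next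
  case (2 x)
  thus ?case
    by (intro has_lebesgue_integral_onI[OF has_bochner_integral_w3_integrand])
       (auto simp: w3_integrand_def abs_minus_commute[of x])
next
  case (3 x)
  thus ?case
    unfolding w3_eq_w4 w1_commute[of _ a b]
    by (intro has_lebesgue_integral_onI[OF has_bochner_integral_w1_integrand])
       (auto simp: w1_integrand_def)
next
  case (4 x)
  thus ?case
    unfolding w3_eq_w4[of _ b a, symmetric] w2_commute[of x a]
    by (intro has_lebesgue_integral_onI[OF has_bochner_integral_w3_integrand])
       (auto simp: w3_integrand_def)
qed

end
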